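(* For all integers $r,D\geqslant 2$ and every $\varepsilon>0$ there exists $C>0$ such that the following holds. If $p\geqslant C n^{-2/(r+1)}$ and $N\geqslant rn+\varepsilon n$, then with high probability (as $n\to\infty$) $G(N,p)\rightarrow\big(K_{r+1},\mathcal{T}(n,D)\big)$.
   Context: $G(N,p)$ is the Erdős–Rényi random graph on $N$ vertices with edge probability $p$. $\mathcal{T}(n,D)$ denotes the class of all trees with $n$ edges and maximum degree at most $D$. For a graph $G$, $G\rightarrow (K_{r+1},\mathcal{T}(n,D))$ means that every blue-red colouring of the edges of $G$ contains either a blue copy of $K_{r+1}$ or a red copy of every tree $T\in\mathcal{T}(n,D)$. "With high probability" means with probability tending to $1$. *)

theory Defs
  imports "HOL-Probability.Probability" "HOL-Probability.Product_PMF"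
begin

text \<open>Simple undirected graphs: edges are two-element sets of vertices.\<close>

datatype 'a graph = Graph (verts: "'a set") (edges: "'a set set")

definition simple_graph :: "'a graph \<Rightarrow> bool" where
  "simple_graph G \<longleftrightarrow> (\<forall>e\<in>edges G. e \<subseteq> verts G \<and> card e = 2)"

definition complete_graph :: "'a set \<Rightarrow> 'a graph" where
  "complete_graph V = Graph V {e. e \<subseteq> V \<and> card e = 2}"

definition degree :: "'a graph \<Rightarrow> 'a \<Rightarrow> nat" where
  "degree G v = card {e \<in> edges G. v \<in> e}"

definition connected_graph :: "'a graph \<Rightarrow> bool" where
  "connected_graph G \<longleftrightarrow> verts G \<noteq> {} \<and>
     (\<forall>u\<in>verts G. \<forall>v\<in>verts G. (u, v) \<in> {(x, y). {x, y} \<in> edges G}\<^sup>*)"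

definition is_cycle :: "'a graph \<Rightarrow> 'a list \<Rightarrow> bool" where
  "is_cycle G xs \<longleftrightarrow> length xs \<ge> 3 \<and> distinct xs \<and>
     (\<forall>i<length xs. {xs ! i, xs ! (Suc i mod length xs)} \<in> edges G)"

definition is_tree :: "'a graph \<Rightarrow> bool" where
  "is_tree T \<longleftrightarrow> simple_graph T \<and> finite (verts T) \<and> connected_graph T \<and> (\<nexists>xs. is_cycle T xs)"

text \<open>Vertices are taken in \<^typ>\<open>nat\<close>; this covers every finite tree up to isomorphism.\<close>

definition trees :: "nat \<Rightarrow> nat \<Rightarrow> nat graph set" where
  "trees n D = {T. is_tree T \<and> card (edges T) = n \<and> (\<forall>v\<in>verts T. degree T v \<le> D)}"

text \<open>Copies are subgraphs, not necessarily induced.\<close>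

definition contains_copy :: "'a graph \<Rightarrow> 'b graph \<Rightarrow> bool" where
  "contains_copy G H \<longleftrightarrow>
     (\<exists>f. inj_on f (verts H) \<and> f ` verts H \<subseteq> verts G \<and> (\<forall>e\<in>edges H. f ` e \<in> edges G))"

datatype colour = Blue | Red

definition colour_class :: "'a graph \<Rightarrow> ('a set \<Rightarrow> colour) \<Rightarrow> colour \<Rightarrow> 'a graph" where
  "colour_class G c k = Graph (verts G) {e \<in> edges G. c e = k}"

definition arrows :: "'a graph \<Rightarrow> 'b graph \<Rightarrow> 'c graph set \<Rightarrow> bool" where
  "arrows G H \<T> \<longleftrightarrow>
     (\<forall>c. contains_copy (colour_class G c Blue) H \<or>
          (\<forall>T\<in>\<T>. contains_copy (colour_class G c Red) T))"

definition erdos_renyi :: "nat \<Rightarrow> real \<Rightarrow> nat graph pmf" where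
  "erdos_renyi N p =
     map_pmf (\<lambda>b. Graph {..<N} {e \<in> edges (complete_graph {..<N}). b e})
       (Pi_pmf (edges (complete_graph {..<N})) False (\<lambda>_. bernoulli_pmf p))"

end

theory Submission
  imports Defs "HOL-Real_Asymp.Real_Asymp"
begin

text \<open>Put \<^term>\<open>m = nat \<lfloor>\<delta> * n\<rfloor>\<close> for a small constant \<^term>\<open>\<delta>\<close>. With high probability any
  \<^term>\<open>r + 1\<close> disjoint \<^term>\<open>m\<close>-sets of vertices span a transversal clique: by Janson's inequality
  a given choice fails with probability \<^term>\<open>exp (- K * n)\<close>, where \<^term>\<open>K\<close> grows with the constant
  \<^term>\<open>C\<close>, and this beats the exponential number of choices. So if there is no blue clique, then among
  any \<^term>\<open>r + 1\<close> such sets some two are joined by a red edge. This alone forces all the trees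
  in red, by induction on \<^term>\<open>r\<close>. If some \<^term>\<open>m\<close>-set has a closed red neighbourhood of size less than
  about \<^term>\<open>n\<close>, delete that neighbourhood; what remains has no \<^term>\<open>r\<close> pairwise unjoined \<^term>\<open>m\<close>-sets.
  Otherwise, deleting a largest badly expanding set leaves an expander, in which the tree is
  embedded vertex by vertex as in the Friedman--Pippenger theorem.\<close>

section \<open>Embedding trees in expanders\<close>

text \<open>Here \<^term>\<open>A\<close> is the set of vertices used so far and \<^term>\<open>B x\<close> the number of children that may
  still have to be attached at \<^term>\<open>x\<close>. Every \<^term>\<open>y\<close> that cannot be attached to \<^term>\<open>s\<close> lies in the
  neighbourhood of a critical set, for which \<^term>\<open>good\<close> is an equality. Submodularity makes critical
  sets closed under union, and adding \<^term>\<open>s\<close> to the union of all of them violates \<^term>\<open>good\<close>.\<close>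

lemma tree_extension_step:
  fixes N :: "'a \<Rightarrow> 'a set" and B :: "'a \<Rightarrow> nat"
  assumes fin: "finite V" and NV: "\<And>x. x \<in> V \<Longrightarrow> N x \<subseteq> V"
    and good: "\<And>X. X \<subseteq> V \<Longrightarrow> card X \<le> 2 * m \<Longrightarrow> sum B X \<le> card (\<Union>(N ` X) - A)"
    and big: "\<And>X. X \<subseteq> V \<Longrightarrow> m \<le> card X \<Longrightarrow> card X \<le> 2 * m \<Longrightarrow> sum B X < card (\<Union>(N ` X) - A)"
    and s: "s \<in> V" "B s \<ge> 1"
  shows "\<exists>y\<in>N s - A. \<forall>X\<subseteq>V. card X \<le> 2 * m \<longrightarrow>
           sum (B(s := B s - 1)) X \<le> card (\<Union>(N ` X) - insert y A)"
proof (rule ccontr)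
  define nb where "nb X = \<Union>(N ` X) - A" for X
  define crit where "crit X \<longleftrightarrow> X \<subseteq> V \<and> card X < m \<and> card (nb X) = sum B X" for X
  have fin_nb: "finite (nb X)" if "X \<subseteq> V" for X
    unfolding nb_def using that NV fin by (intro finite_Diff finite_UN_I) (auto intro: finite_subset)
  have finX: "finite X" if "X \<subseteq> V" for X using that fin finite_subset by blast
  assume neg: "\<not> ?thesis"
  \<comment> \<open>If \<open>y\<close> cannot be used, some set \<open>X\<close> violates the new
    inequality, although it loses at most the one neighbour \<open>y\<close>. A set containing
    \<open>s\<close> would also lose one unit of budget, which compensates; so \<open>s\<close> lies
    outside \<open>X\<close> and \<open>good\<close> was an equality there. Then \<open>big\<close>
    forces \<open>card X < m\<close>.\<close>
  have "\<exists>X. crit X \<and> y \<in> nb X \<and> s \<notin> X" if y: "y \<in> N s - A" for y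
  proof -
    obtain X where X: "X \<subseteq> V" "card X \<le> 2 * m"
      and less: "card (\<Union>(N ` X) - insert y A) < sum (B(s := B s - 1)) X"
      using neg y by (meson not_le_imp_less)
    have eq: "\<Union>(N ` X) - insert y A = nb X - {y}" by (auto simp: nb_def)
    have g: "sum B X \<le> card (nb X)" using good X unfolding nb_def by blast
    have c1: "card (nb X) \<le> card (nb X - {y}) + 1"
      by (simp add: card_Diff_singleton_if, arith)
    have sX: "s \<notin> X"
    proof
      assume "s \<in> X"
      then have "sum B X = B s + sum B (X - {s})" using finX[OF X(1)] by (simp add: sum.remove)
      moreover have "sum (B(s := B s - 1)) X = B s - 1 + sum B (X - {s})"
        using \<open>s \<in> X\<close> finX[OF X(1)] by (simp add: sum.remove[of X s])
      ultimately show False using less g c1 s eq by simp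
    qed
    then have same: "sum (B(s := B s - 1)) X = sum B X" by (intro sum.cong) auto
    have yX: "y \<in> nb X"
      using less g same eq by (metis Diff_empty Diff_insert0 leD)
    have e: "card (nb X) = sum B X" using c1 less g same eq by simp
    moreover have "card X < m"
      using big[OF X(1) _ X(2)] e unfolding nb_def by fastforce
    ultimately show ?thesis using X sX yX by (auto simp: crit_def)
  qed
  then obtain F where F: "\<And>y. y \<in> N s - A \<Longrightarrow> crit (F y) \<and> y \<in> nb (F y) \<and> s \<notin> F y" by metis
  \<comment> \<open>Critical sets have fewer than \<open>m\<close> elements, so their union stays
    within the range \<open>2 * m\<close> of \<open>good\<close>. Once it is known to attain
    equality, \<open>big\<close> brings its size back below \<open>m\<close>.\<close>
  have crit_Un: "crit (X \<union> Y)" if "crit X" "crit Y" for X Y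
  proof -
    have XY: "X \<subseteq> V" "Y \<subseteq> V" "card X < m" "card Y < m"
      "card (nb X) = sum B X" "card (nb Y) = sum B Y" using that by (auto simp: crit_def)
    have cU: "card (X \<union> Y) \<le> 2 * m" using card_Un_le[of X Y] XY by linarith
    have cI: "card (X \<inter> Y) \<le> 2 * m"
      using card_mono[of X "X \<inter> Y"] finX XY by fastforce
    have "card (nb (X \<union> Y)) + card (nb (X \<inter> Y)) \<le> card (nb X \<union> nb Y) + card (nb X \<inter> nb Y)"
      by (intro add_mono card_mono) (use fin_nb XY in \<open>auto simp: nb_def\<close>)
    also have "\<dots> = sum B X + sum B Y" using card_Un_Int[of "nb X" "nb Y"] fin_nb XY by simp
    also have "\<dots> = sum B (X \<union> Y) + sum B (X \<inter> Y)"
      using sum.union_inter[of X Y B] finX XY by simp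
    finally have le: "card (nb (X \<union> Y)) + card (nb (X \<inter> Y)) \<le> sum B (X \<union> Y) + sum B (X \<inter> Y)" .
    have u: "sum B (X \<union> Y) \<le> card (nb (X \<union> Y))" unfolding nb_def using XY cU by (intro good) auto
    have i: "sum B (X \<inter> Y) \<le> card (nb (X \<inter> Y))" unfolding nb_def using XY cI by (intro good) auto
    have e: "card (nb (X \<union> Y)) = sum B (X \<union> Y)" using le u i by simp
    moreover have "card (X \<union> Y) < m"
      using big[of "X \<union> Y"] cU e XY unfolding nb_def by fastforce
    ultimately show ?thesis using XY by (auto simp: crit_def)
  qed
  have "m > 0" using big[of "{}"] by fastforce
  then have crit0: "crit {}" by (auto simp: crit_def nb_def)
  have "crit (\<Union>(F ` Y))" if "finite Y" "Y \<subseteq> N s - A" for Y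
    using that by (induction rule: finite_induct) (use crit0 crit_Un F in auto)
  moreover define X where "X = \<Union>(F ` (N s - A))"
  moreover have "finite (N s - A)" using NV s fin by (meson finite_Diff finite_subset)
  ultimately have cX: "crit X" by simp
  have sX: "s \<notin> X" using F by (auto simp: X_def)
  have "nb (insert s X) = nb X" using F by (fastforce simp: nb_def X_def)
  moreover have "sum B (insert s X) \<le> card (nb (insert s X))"
    unfolding nb_def using cX s sX finX
    by (intro good) (auto simp: crit_def card_insert_if)
  ultimately show False using cX sX s finX[of X] by (simp add: crit_def)
qed

text \<open>Here \<open>par\<close> encodes a tree on \<open>{..n}\<close> rooted at 0. Vertices are
  placed in order, and the budget of a placed vertex is \<open>D\<close> minus the number of its
  children already placed. For sets of size between \<open>m\<close> and \<open>2 * m\<close>, the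
  surplus in \<open>large\<close> pays for at most \<open>n\<close> used vertices and the largest
  possible budget, which gives the strict inequality required by the extension step.\<close>

lemma friedman_pippenger:
  fixes N :: "'a \<Rightarrow> 'a set" and par :: "nat \<Rightarrow> nat"
  assumes fin: "finite V" and NV: "\<And>x. x \<in> V \<Longrightarrow> N x \<subseteq> V" and v0: "v0 \<in> V"
    and par: "\<And>i. i \<in> {1..n} \<Longrightarrow> par i < i"
    and children: "\<And>j. card {i \<in> {1..n}. par i = j} \<le> D"
    and small: "\<And>X. X \<subseteq> V \<Longrightarrow> card X < m \<Longrightarrow> D * card X \<le> card (\<Union>(N ` X) - {v0})"
    and large: "\<And>X. X \<subseteq> V \<Longrightarrow> m \<le> card X \<Longrightarrow> card X \<le> 2 * m \<Longrightarrow>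
                   n + 2 * D * m < card (\<Union>(N ` X))"
  shows "\<exists>g. inj_on g {..n} \<and> g ` {..n} \<subseteq> V \<and> (\<forall>i\<in>{1..n}. g i \<in> N (g (par i)))"
proof -
  define kids where "kids k j = {i \<in> {1..k}. par i = j}" for k j
  have large': "D * card X < card (\<Union>(N ` X) - A)"
    if "X \<subseteq> V" "m \<le> card X" "card X \<le> 2 * m" "card A \<le> n" "finite A" for X A
  proof -
    have "n + 2 * D * m < card (\<Union>(N ` X))" using large that by blast
    moreover have "card (\<Union>(N ` X)) - card A \<le> card (\<Union>(N ` X) - A)"
      using that by (intro diff_card_le_card_Diff)
    moreover have "D * card X \<le> 2 * D * m" using mult_le_mono2[OF that(3), of D] by simp
    ultimately show ?thesis using that(4) by linarith
  qed
  \<comment> \<open>Unplaced vertices carry the full budget \<open>D\<close> in the invariant: a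
    newly placed vertex has no placed children, since \<open>par i < i\<close>, so it starts with
    the right value.\<close>
  have "\<exists>g B. inj_on g {..k} \<and> g ` {..k} \<subseteq> V \<and> (\<forall>i\<in>{1..k}. g i \<in> N (g (par i))) \<and>
      (\<forall>j\<le>k. B (g j) = D - card (kids k j)) \<and> (\<forall>x. B x \<le> D) \<and> (\<forall>x. x \<notin> g ` {..k} \<longrightarrow> B x = D) \<and>
      (\<forall>X\<subseteq>V. card X \<le> 2 * m \<longrightarrow> sum B X \<le> card (\<Union>(N ` X) - g ` {..k}))" if "k \<le> n" for k
    using that
  proof (induction k)
    case 0
    \<comment> \<open>For \<open>n = 0\<close> the root alone exceeds the \<open>n\<close> used
      vertices that \<open>large'\<close> allows for; the strict inequality in \<open>large\<close>
      absorbs its loss.\<close>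
    have "D * card X \<le> card (\<Union>(N ` X) - {v0})" if "X \<subseteq> V" "card X \<le> 2 * m" for X
    proof (cases "n = 0 \<or> card X < m")
      case False
      then show ?thesis using large'[of X "{v0}"] that by simp
    next
      case True
      show ?thesis
      proof (cases "card X < m")
        case False
        then have "n + 2 * D * m < card (\<Union>(N ` X))" using large that by simp
        moreover have "card (\<Union>(N ` X)) - 1 \<le> card (\<Union>(N ` X) - {v0})"
          by (simp add: card_Diff_singleton_if)
        moreover have "D * card X \<le> 2 * D * m" using mult_le_mono2[OF that(2), of D] by simp
        ultimately show ?thesis by linarith
      qed (use small that in simp)
    qed
    then show ?case using v0
      by (intro exI[of _ "\<lambda>_. v0"] exI[of _ "\<lambda>_. D"]) (auto simp: kids_def mult.commute)
  next
    case (Suc k)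
    then obtain g B where g: "inj_on g {..k}" "g ` {..k} \<subseteq> V" "\<forall>i\<in>{1..k}. g i \<in> N (g (par i))"
      and B: "\<forall>j\<le>k. B (g j) = D - card (kids k j)" "\<forall>x. B x \<le> D" "\<forall>x. x \<notin> g ` {..k} \<longrightarrow> B x = D"
      and good: "\<forall>X\<subseteq>V. card X \<le> 2 * m \<longrightarrow> sum B X \<le> card (\<Union>(N ` X) - g ` {..k})"
      by auto
    define j where "j = par (Suc k)"
    have j: "j \<le> k" using par[of "Suc k"] Suc.prems by (simp add: j_def)
    have kidsS: "kids (Suc k) i = (if i = j then insert (Suc k) (kids k i) else kids k i)" for i
      by (auto simp: kids_def j_def le_Suc_eq)
    have nin: "Suc k \<notin> kids k i" for i by (simp add: kids_def)
    have fk: "finite (kids k i)" for i by (simp add: kids_def)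
    have "card (kids (Suc k) j) \<le> card (kids n j)"
      using Suc.prems by (intro card_mono) (auto simp: kids_def)
    moreover have "card (kids n j) \<le> D"
      using children[of j] by (simp only: kids_def)
    moreover have "card (kids (Suc k) j) = Suc (card (kids k j))"
      using nin fk by (simp add: kidsS)
    ultimately have kj: "card (kids k j) < D" by linarith
    have sumB: "sum B X \<le> D * card X" for X
      using sum_bounded_above[of X B D] B(2) by (simp add: mult.commute)
    have "card (g ` {..k}) \<le> n" using card_image_le[of "{..k}" g] Suc.prems by simp
    then have big: "sum B X < card (\<Union>(N ` X) - g ` {..k})"
      if "X \<subseteq> V" "m \<le> card X" "card X \<le> 2 * m" for X
      using large'[OF that, of "g ` {..k}"] sumB[of X] by simp
    have Bj: "1 \<le> B (g j)" using B(1) j kj by simp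
    have gj: "g j \<in> V" using g(2) j by auto
    obtain y where y: "y \<in> N (g j) - g ` {..k}"
      and good': "\<forall>X\<subseteq>V. card X \<le> 2 * m \<longrightarrow> sum (B(g j := B (g j) - 1)) X \<le>
           card (\<Union>(N ` X) - insert y (g ` {..k}))"
      using tree_extension_step[of V N m B "g ` {..k}" "g j", OF fin NV _ big gj Bj] good by blast
    have yV: "y \<in> V" using NV[OF gj] y by auto
    have yj: "y \<noteq> g j" using y j by auto
    define g' where "g' = g(Suc k := y)"
    define B' where "B' = B(g j := B (g j) - 1)"
    have g'i: "g' i = g i" if "i \<le> k" for i using that by (simp add: g'_def)
    have im: "g' ` {..Suc k} = insert y (g ` {..k})"
      by (auto simp: g'_def atMost_Suc image_def)
    have 1: "inj_on g' {..Suc k}"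
      using g(1) y unfolding g'_def atMost_Suc by (auto simp: inj_on_def)
    have 2: "g' i \<in> N (g' (par i))" if "i \<in> {1..Suc k}" for i
    proof (cases "i = Suc k")
      case True
      then show ?thesis using y j by (simp add: g'_def j_def[symmetric])
    next
      case False
      then have i: "i \<in> {1..k}" using that by auto
      moreover have "par i < i" using par[of i] i Suc.prems by simp
      ultimately show ?thesis using g(3) by (simp add: g'_def)
    qed
    have 3: "B' (g' i) = D - card (kids (Suc k) i)" if "i \<le> Suc k" for i
    proof (cases "i = Suc k")
      case True
      have "kids (Suc k) (Suc k) = {}" using par Suc.prems by (fastforce simp: kids_def)
      then show ?thesis using True y yj B(3) by (simp add: g'_def B'_def)
    next
      case False
      then have i: "i \<le> k" using that by simp
      then have "g i = g j \<longleftrightarrow> i = j" using g(1) j by (auto simp: inj_on_def)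
      then show ?thesis using i B(1) j kj nin fk
        by (auto simp: B'_def g'i kidsS)
    qed
    have 4: "B' x \<le> D" for x using B(2)[rule_format, of x] B(2)[rule_format, of "g j"] unfolding B'_def by auto
    have 5: "B' x = D" if "x \<notin> insert y (g ` {..k})" for x using B(3) that j by (auto simp: B'_def)
    have 6: "g' ` {..Suc k} \<subseteq> V" using g(2) yV by (simp add: im)
    show ?case
      using 1 2 3 4 5 6 good'[folded B'_def] unfolding im[symmetric] by blast
  qed
  from this[of n] show ?thesis by blast
qed

section \<open>Tree embedding from the absence of separated sets\<close>

definition separated_sets :: "('a \<Rightarrow> 'a set) \<Rightarrow> 'a set \<Rightarrow> nat \<Rightarrow> nat \<Rightarrow> (nat \<Rightarrow> 'a set) \<Rightarrow> bool" where
  "separated_sets N V m r X \<longleftrightarrow> (\<forall>i<r. X i \<subseteq> V \<and> card (X i) = m) \<and>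
     (\<forall>i<r. \<forall>j<r. i \<noteq> j \<longrightarrow> X i \<inter> X j = {} \<and> \<Union>(N ` X i) \<inter> X j = {})"

text \<open>A largest bad set \<open>W\<close> is deleted. If a small \<open>X\<close> in the rest
  expanded badly, then \<open>W \<union> X\<close> would be either a larger bad set, or a set of at
  least \<open>m\<close> and fewer than \<open>2 * m\<close> vertices whose closed neighbourhood has
  at most \<open>(D + 1) * (2 * m)\<close> elements, against \<open>exp\<close>.\<close>

lemma embed_expanding:
  fixes N :: "'a \<Rightarrow> 'a set" and par :: "nat \<Rightarrow> nat"
  assumes fin: "finite V" and m: "m \<ge> 1"
    and par: "\<And>i. i \<in> {1..n} \<Longrightarrow> par i < i"
    and children: "\<And>j. card {i \<in> {1..n}. par i = j} \<le> D"
    and V: "m \<le> card V"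
    and exp: "\<And>X. X \<subseteq> V \<Longrightarrow> card X = m \<Longrightarrow>
      n + (2 * D + 4) * m \<le> card (X \<union> \<Union>(N ` X) \<inter> V)"
  shows "\<exists>g. inj_on g {..n} \<and> g ` {..n} \<subseteq> V \<and> (\<forall>i\<in>{1..n}. g i \<in> N (g (par i)))"
proof -
  define bad where "bad W \<longleftrightarrow> W \<subseteq> V \<and> card W < m \<and> card (\<Union>(N ` W) \<inter> V - W) \<le> D * card W" for W
  have finX: "finite X" if "X \<subseteq> V" for X using that fin finite_subset by blast
  have exp': "n + (2 * D + 4) * m \<le> card (X \<union> \<Union>(N ` X) \<inter> V)" if "X \<subseteq> V" "m \<le> card X" for X
  proof -
    obtain Y where Y: "Y \<subseteq> X" "card Y = m" using \<open>m \<le> card X\<close> by (meson obtain_subset_with_card_n)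
    have "n + (2 * D + 4) * m \<le> card (Y \<union> \<Union>(N ` Y) \<inter> V)" using Y that by (intro exp) auto
    also have "\<dots> \<le> card (X \<union> \<Union>(N ` X) \<inter> V)"
      using Y finX[OF that(1)] fin by (intro card_mono) auto
    finally show ?thesis .
  qed
  have "bad {}" using m by (simp add: bad_def)
  moreover have "\<forall>W. bad W \<longrightarrow> card W < m" by (simp add: bad_def)
  ultimately obtain W where W: "bad W" and max: "\<And>W'. bad W' \<Longrightarrow> card W' \<le> card W"
    using ex_has_greatest_nat[of bad "{}" card m] by fastforce
  define V' where "V' = V - W"
  define N' where "N' x = N x \<inter> V'" for x
  have WV: "W \<subseteq> V" "card W < m" using W by (auto simp: bad_def)
  have UN': "\<Union>(N' ` X) = \<Union>(N ` X) \<inter> V'" for X by (auto simp: N'_def)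
  have "card V' = card V - card W" unfolding V'_def using WV finX by (intro card_Diff_subset) auto
  then have "V' \<noteq> {}" using WV V by auto
  then obtain v0 where v0: "v0 \<in> V'" by blast
  have "\<exists>g. inj_on g {..n} \<and> g ` {..n} \<subseteq> V' \<and> (\<forall>i\<in>{1..n}. g i \<in> N' (g (par i)))"
  proof (rule friedman_pippenger[of V' N' v0 n par D m])
    show "finite V'" using fin by (simp add: V'_def)
    fix X assume X: "X \<subseteq> V'"
    then have XV: "X \<subseteq> V" and disj: "W \<inter> X = {}" by (auto simp: V'_def)
    {
      assume cX: "card X < m"
      show "D * card X \<le> card (\<Union>(N' ` X) - {v0})"
      proof (rule ccontr)
        assume "\<not> ?thesis"
        then have less: "card (\<Union>(N' ` X) - {v0}) < D * card X" by simp
        then have ne: "X \<noteq> {}" by auto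
        \<comment> \<open>Putting the root back adds at most one vertex, which turns the strict
          bound into a weak one. This is why \<open>bad\<close> uses a weak inequality.\<close>
        have "card (\<Union>(N' ` X)) \<le> D * card X"
          using less by (simp add: card_Diff_singleton_if split: if_splits)
        then have a: "card (\<Union>(N ` X) \<inter> V') \<le> D * card X" by (simp add: UN')
        have cu: "card (W \<union> X) = card W + card X"
          using disj finX WV XV by (intro card_Un_disjoint) auto
        have "card (\<Union>(N ` (W \<union> X)) \<inter> V - (W \<union> X)) \<le>
            card ((\<Union>(N ` W) \<inter> V - W) \<union> (\<Union>(N ` X) \<inter> V'))"
          using fin by (intro card_mono) (auto simp: V'_def)
        also have "\<dots> \<le> D * card W + D * card X"
          using a W by (intro order_trans[OF card_Un_le] add_mono) (auto simp: bad_def)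
        finally have b: "card (\<Union>(N ` (W \<union> X)) \<inter> V - (W \<union> X)) \<le> D * card (W \<union> X)"
          by (simp only: cu distrib_left)
        show False
        proof (cases "card (W \<union> X) < m")
          case True
          then have "bad (W \<union> X)" using b WV XV by (simp add: bad_def)
          from max[OF this] show False using cu ne finX[OF XV] by simp
        next
          case False
          then have "n + (2 * D + 4) * m \<le> card ((W \<union> X) \<union> \<Union>(N ` (W \<union> X)) \<inter> V)"
            using WV XV by (intro exp') auto
          also have "\<dots> = card ((W \<union> X) \<union> (\<Union>(N ` (W \<union> X)) \<inter> V - (W \<union> X)))"
            by (rule arg_cong[of _ _ card]) auto
          also have "\<dots> \<le> card (W \<union> X) + D * card (W \<union> X)"
            using b by (intro order_trans[OF card_Un_le] add_mono order_refl)
          also have "\<dots> = (D + 1) * card (W \<union> X)" by simp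
          also have "\<dots> \<le> (D + 1) * (2 * m)"
            using cu WV cX by (intro mult_le_mono) auto
          finally show False using m by (simp add: algebra_simps)
        qed
      qed
    }
    {
      assume cX: "m \<le> card X" "card X \<le> 2 * m"
      obtain Y where Y: "Y \<subseteq> X" "card Y = m" using cX by (meson obtain_subset_with_card_n)
      then have YV: "Y \<subseteq> V" using XV by simp
      \<comment> \<open>The set \<open>Y\<close> itself and the deleted \<open>W\<close> cost at
        most \<open>m\<close> vertices each, so the constant \<open>2 * D + 4\<close> leaves more
        than the \<open>2 * D\<close> required here.\<close>
      have "n + (2 * D + 4) * m \<le> card (Y \<union> \<Union>(N ` Y) \<inter> V)" using exp[OF YV Y(2)] .
      also have "\<dots> \<le> card (Y \<union> (W \<union> \<Union>(N ` X) \<inter> V'))"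
        using Y(1) fin finX WV YV by (intro card_mono) (auto simp: V'_def)
      also have "\<dots> \<le> m + (card W + card (\<Union>(N ` X) \<inter> V'))"
        using Y(2) by (intro order_trans[OF card_Un_le] add_mono card_Un_le) auto
      also have "\<dots> < 2 * m + card (\<Union>(N' ` X))" using WV by (simp add: UN')
      finally show "n + 2 * D * m < card (\<Union>(N' ` X))" by (simp add: algebra_simps)
    }
  qed (use v0 par children in \<open>auto simp: N'_def\<close>)
  then show ?thesis by (fastforce simp: N'_def V'_def)
qed

text \<open>For \<open>r = 0\<close> a single \<open>m\<close>-set is already a separated family, a
  contradiction. In the inductive step an \<open>m\<close>-set with small closed neighbourhood
  extends every separated family that avoids this neighbourhood. Deleting it therefore lowers the
  index by one and costs fewer than \<open>n + (2 * D + 4) * m\<close> vertices, the allowance per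
  unit of \<open>r\<close>.\<close>

lemma embed_without_separated_sets:
  fixes N :: "'a \<Rightarrow> 'a set" and par :: "nat \<Rightarrow> nat"
  assumes sym: "\<And>x y. y \<in> N x \<longleftrightarrow> x \<in> N y" and m: "m \<ge> 1"
    and par: "\<And>i. i \<in> {1..n} \<Longrightarrow> par i < i"
    and children: "\<And>j. card {i \<in> {1..n}. par i = j} \<le> D"
    and "finite V" and "r * (n + (2 * D + 4) * m) + m \<le> card V"
    and "\<nexists>X. separated_sets N V m (Suc r) X"
  shows "\<exists>g. inj_on g {..n} \<and> g ` {..n} \<subseteq> V \<and> (\<forall>i\<in>{1..n}. g i \<in> N (g (par i)))"
  using assms(5-)
proof (induction r arbitrary: V)
  case 0
  then obtain X where "X \<subseteq> V" "card X = m" by (metis add_0 mult_0 obtain_subset_with_card_n)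
  then have "separated_sets N V m (Suc 0) (\<lambda>_. X)" by (simp add: separated_sets_def)
  then show ?case using "0.prems" by blast
next
  case (Suc r)
  show ?case
  proof (cases "\<forall>X\<subseteq>V. card X = m \<longrightarrow> n + (2 * D + 4) * m \<le> card (X \<union> \<Union>(N ` X) \<inter> V)")
    case True
    then show ?thesis using Suc.prems by (intro embed_expanding[OF _ m par children]) auto
  next
    case False
    then obtain X where X: "X \<subseteq> V" "card X = m" "card (X \<union> \<Union>(N ` X) \<inter> V) < n + (2 * D + 4) * m"
      by (auto simp: not_le)
    define V' where "V' = V - (X \<union> \<Union>(N ` X) \<inter> V)"
    have V'V: "V' \<subseteq> V" by (auto simp: V'_def)
    have "card V' = card V - card (X \<union> \<Union>(N ` X) \<inter> V)"
      unfolding V'_def using X Suc.prems(1) by (intro card_Diff_subset) (auto intro: finite_subset)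
    then have c: "r * (n + (2 * D + 4) * m) + m \<le> card V'" using X(3) Suc.prems(2) by simp
    have "\<nexists>Y. separated_sets N V' m (Suc r) Y"
    proof
      assume "\<exists>Y. separated_sets N V' m (Suc r) Y"
      then obtain Y where Y: "separated_sets N V' m (Suc r) Y" by blast
      have *: "X \<inter> Y i = {}" "Y i \<inter> X = {}" "\<Union>(N ` X) \<inter> Y i = {}" if "i < Suc r" for i
        using Y that unfolding separated_sets_def V'_def by blast+
      then have **: "\<Union>(N ` Y i) \<inter> X = {}" if "i < Suc r" for i
        using sym that by (fastforce)
      have "Y i \<subseteq> V" if "i < Suc r" for i
        using Y that V'V unfolding separated_sets_def by blast
      then have "separated_sets N V m (Suc (Suc r)) (Y(Suc r := X))"
        using Y X * ** unfolding separated_sets_def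
        by (auto simp: less_Suc_eq_le[of _ "Suc r"] le_Suc_eq less_Suc_eq_le)
      then show False using Suc.prems(3) by blast
    qed
    from Suc.IH[OF _ c this] have "\<exists>g. inj_on g {..n} \<and> g ` {..n} \<subseteq> V' \<and> (\<forall>i\<in>{1..n}. g i \<in> N (g (par i)))"
      using Suc.prems(1) V'V finite_subset by blast
    then show ?thesis using V'V by blast
  qed
qed

section \<open>Enumerating trees from a root\<close>

text \<open>Connectivity through simple paths inside \<open>S\<close>: such a path closes up to a
  cycle through a vertex outside \<open>S\<close>, which a mere walk need not do.\<close>

definition linked :: "'a graph \<Rightarrow> 'a set \<Rightarrow> bool" where
  "linked T S \<longleftrightarrow> (\<forall>a\<in>S. \<forall>b\<in>S. \<exists>xs. xs \<noteq> [] \<and> distinct xs \<and> set xs \<subseteq> S \<and>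
     hd xs = a \<and> last xs = b \<and> successively (\<lambda>u v. {u, v} \<in> edges T) xs)"

lemma linked_insert:
  assumes S: "linked T S" and v: "v \<notin> S" and a: "a \<in> S" "{a, v} \<in> edges T"
  shows "linked T (insert v S)"
  unfolding linked_def
proof (intro ballI)
  fix x y assume xy: "x \<in> insert v S" "y \<in> insert v S"
  let ?P = "\<lambda>x y xs. xs \<noteq> [] \<and> distinct xs \<and> set xs \<subseteq> insert v S \<and>
     hd xs = x \<and> last xs = y \<and> successively (\<lambda>u v. {u, v} \<in> edges T) xs"
  consider "x = v" "y = v" | "x = v" "y \<in> S" | "x \<in> S" "y = v" | "x \<in> S" "y \<in> S"
    using xy by blast
  then show "\<exists>xs. ?P x y xs"
  proof cases
    case 1
    then show ?thesis by (intro exI[of _ "[v]"]) simp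
  next
    case 2
    then obtain xs where "xs \<noteq> []" "distinct xs" "set xs \<subseteq> S" "hd xs = a" "last xs = y"
      "successively (\<lambda>u v. {u, v} \<in> edges T) xs" using S a unfolding linked_def by blast
    then show ?thesis using 2 v a
      by (intro exI[of _ "v # xs"]) (auto simp: successively_Cons insert_commute)
  next
    case 3
    then obtain xs where "xs \<noteq> []" "distinct xs" "set xs \<subseteq> S" "hd xs = x" "last xs = a"
      "successively (\<lambda>u v. {u, v} \<in> edges T) xs" using S a unfolding linked_def by blast
    then show ?thesis using 3 v a
      by (intro exI[of _ "xs @ [v]"]) (auto simp: successively_append_iff)
  next
    case 4
    then obtain xs where "xs \<noteq> []" "distinct xs" "set xs \<subseteq> S" "hd xs = x" "last xs = y"
      "successively (\<lambda>u v. {u, v} \<in> edges T) xs" using S unfolding linked_def by blast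
    then show ?thesis by (intro exI[of _ xs]) auto
  qed
qed

text \<open>Otherwise a simple path from \<open>a\<close> to \<open>b\<close> inside
  \<open>S\<close>, closed through \<open>v\<close>, is a cycle; it has length at least 3 because
  the path already has two distinct ends.\<close>

lemma acyclic_unique_neighbour:
  assumes S: "linked T S" and acyc: "\<nexists>xs. is_cycle T xs" and v: "v \<notin> S"
    and a: "a \<in> S" "{a, v} \<in> edges T" and b: "b \<in> S" "{b, v} \<in> edges T"
  shows "a = b"
proof (rule ccontr)
  assume "a \<noteq> b"
  obtain xs where xs: "xs \<noteq> []" "distinct xs" "set xs \<subseteq> S" "hd xs = a" "last xs = b"
      "successively (\<lambda>u v. {u, v} \<in> edges T) xs" using S a b unfolding linked_def by blast
  have len: "length xs \<ge> 2"
    using xs \<open>a \<noteq> b\<close> by (cases xs; cases "tl xs") auto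
  define ys where "ys = xs @ [v]"
  have suc: "successively (\<lambda>u v. {u, v} \<in> edges T) ys"
    unfolding ys_def using xs b by (auto simp: successively_append_iff)
  have "{ys ! i, ys ! (Suc i mod length ys)} \<in> edges T" if i: "i < length ys" for i
  proof (cases "Suc i < length ys")
    case True
    then show ?thesis using suc by (simp add: successively_conv_nth)
  next
    case False
    then have "Suc i = length ys" using i by simp
    then have "ys ! i = v" "Suc i mod length ys = 0" by (auto simp: ys_def nth_append)
    moreover have "ys ! 0 = a" using xs by (simp add: ys_def nth_append hd_conv_nth)
    ultimately show ?thesis using a by (simp add: insert_commute)
  qed
  then have "is_cycle T ys" using xs v len by (auto simp: is_cycle_def ys_def)
  then show False using acyc by blast
qed

lemma connected_graph_step:
  assumes "connected_graph T" "simple_graph T" "S \<subset> verts T" "S \<noteq> {}"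
  obtains a v where "a \<in> S" "v \<in> verts T - S" "{a, v} \<in> edges T"
proof -
  obtain a0 v0 where "a0 \<in> S" "v0 \<in> verts T" "v0 \<notin> S" using assms by blast
  then have "(a0, v0) \<in> {(x, y). {x, y} \<in> edges T}\<^sup>*"
    using assms unfolding connected_graph_def by blast
  then have "v0 \<notin> S \<Longrightarrow> \<exists>a v. a \<in> S \<and> v \<notin> S \<and> {a, v} \<in> edges T"
    using \<open>a0 \<in> S\<close> by (induction) auto
  then show ?thesis using \<open>v0 \<notin> S\<close> assms(2) that unfolding simple_graph_def by blast
qed

text \<open>The tree is grown from one vertex along boundary edges. Acyclicity gives each new vertex
  exactly one earlier neighbour, its parent, so the edges inside the enumerated set are precisely
  the parent edges. Their injectivity identifies the number of edges with the last index and later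
  lets children be counted by edges.\<close>

lemma tree_enumeration:
  assumes T: "is_tree T" and n: "card (edges T) = n"
  obtains x :: "nat \<Rightarrow> 'a" and par where "bij_betw x {..n} (verts T)"
    "\<And>i. i \<in> {1..n} \<Longrightarrow> par i < i"
    "edges T = (\<lambda>i. {x i, x (par i)}) ` {1..n}"
    "inj_on (\<lambda>i. {x i, x (par i)}) {1..n}"
proof -
  have simple: "simple_graph T" and fin: "finite (verts T)" and con: "connected_graph T"
    and acyc: "\<nexists>xs. is_cycle T xs" using T by (auto simp: is_tree_def)
  have ne: "verts T \<noteq> {}" using con by (simp add: connected_graph_def)
  have ex: "\<exists>(x :: nat \<Rightarrow> 'a) par. inj_on x {..k} \<and> x ` {..k} \<subseteq> verts T \<and> (\<forall>i\<in>{1..k}. par i < i) \<and>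
      linked T (x ` {..k}) \<and>
      {e \<in> edges T. e \<subseteq> x ` {..k}} = (\<lambda>i. {x i, x (par i)}) ` {1..k}"
    if "k < card (verts T)" for k
    using that
  proof (induction k)
    case 0
    obtain v where v: "v \<in> verts T" using ne by blast
    have "{e \<in> edges T. e \<subseteq> {v}} = {}" using simple by (auto simp: simple_graph_def subset_singleton_iff)
    moreover have "linked T {v}" by (auto simp: linked_def intro!: exI[of _ "[v]"])
    ultimately show ?case using v by (intro exI[of _ "\<lambda>_. v"]) auto
  next
    case (Suc k)
    from Suc.IH[OF Suc_lessD[OF Suc.prems]] obtain x :: "nat \<Rightarrow> 'a" and par
      where x: "inj_on x {..k}" "x ` {..k} \<subseteq> verts T"
      and par: "\<forall>i\<in>{1..k}. par i < i" and lk: "linked T (x ` {..k})"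
      and ed: "{e \<in> edges T. e \<subseteq> x ` {..k}} = (\<lambda>i. {x i, x (par i)}) ` {1..k}"
      by (elim exE conjE)
    have "card (x ` {..k}) = Suc k" using x by (simp add: card_image)
    then have "x ` {..k} \<noteq> verts T" using Suc.prems by auto
    then have "x ` {..k} \<subset> verts T" using x(2) by blast
    then obtain a v where av: "a \<in> x ` {..k}" "v \<in> verts T - x ` {..k}" "{a, v} \<in> edges T"
      using connected_graph_step[OF con simple] by blast
    obtain j where j: "j \<le> k" "a = x j" using av by blast
    define y where "y = x(Suc k := v)"
    define par' where "par' = par(Suc k := j)"
    have im: "y ` {..Suc k} = insert v (x ` {..k})" by (auto simp: y_def image_def atMost_Suc)
    have inj: "inj_on y {..Suc k}"
      using x(1) av(2) unfolding y_def atMost_Suc by (auto simp: inj_on_def)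
    have eqs: "(\<lambda>i. {y i, y (par' i)}) ` {1..k} = (\<lambda>i. {x i, x (par i)}) ` {1..k}"
    proof (rule image_cong[OF refl])
      fix i assume "i \<in> {1..k}"
      then have "i \<le> k" "par i < i" using par by auto
      then show "{y i, y (par' i)} = {x i, x (par i)}" by (simp add: y_def par'_def)
    qed
    have "{e \<in> edges T. e \<subseteq> insert v (x ` {..k})} = insert {v, a} {e \<in> edges T. e \<subseteq> x ` {..k}}"
    proof (intro equalityI subsetI)
      fix e assume "e \<in> insert {v, a} {e \<in> edges T. e \<subseteq> x ` {..k}}"
      then show "e \<in> {e \<in> edges T. e \<subseteq> insert v (x ` {..k})}"
        using av by (auto simp: insert_commute)
    next
      fix e assume e: "e \<in> {e \<in> edges T. e \<subseteq> insert v (x ` {..k})}"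
      show "e \<in> insert {v, a} {e \<in> edges T. e \<subseteq> x ` {..k}}"
      proof (cases "v \<in> e")
        case True
        have "card e = 2" using e simple by (auto simp: simple_graph_def)
        then obtain b where b: "e = {v, b}" "b \<noteq> v"
          using True by (auto simp: card_2_iff doubleton_eq_iff)
        then have "b \<in> x ` {..k}" "{b, v} \<in> edges T" using e by (auto simp: insert_commute)
        then have "b = a" using acyclic_unique_neighbour[OF lk acyc _ _ _ av(1) av(3)] av(2) by blast
        then show ?thesis using b by simp
      qed (use e in auto)
    qed
    also have "\<dots> = (\<lambda>i. {y i, y (par' i)}) ` {1..Suc k}"
      unfolding ed eqs[symmetric] using j by (auto simp: atLeastAtMostSuc_conv y_def par'_def)
    finally have edk: "{e \<in> edges T. e \<subseteq> insert v (x ` {..k})} = (\<lambda>i. {y i, y (par' i)}) ` {1..Suc k}" .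
    have "linked T (insert v (x ` {..k}))" using linked_insert[OF lk _ av(1) av(3)] av(2) by blast
    moreover have "\<forall>i\<in>{1..Suc k}. par' i < i" using par j by (auto simp: par'_def)
    ultimately show ?case
      using inj edk x(2) av(2) by (intro exI[of _ y] exI[of _ par']) (simp add: im)
  qed
  define k where "k = card (verts T) - 1"
  have k: "card (verts T) = Suc k" using ne fin by (simp add: k_def card_gt_0_iff)
  obtain x :: "nat \<Rightarrow> 'a" and par where x: "inj_on x {..k}" "x ` {..k} \<subseteq> verts T"
      and par: "\<forall>i\<in>{1..k}. par i < i"
      and ed: "{e \<in> edges T. e \<subseteq> x ` {..k}} = (\<lambda>i. {x i, x (par i)}) ` {1..k}"
    using ex[OF lessI[of k, folded k]] by (elim exE conjE)
  have im: "x ` {..k} = verts T"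
    using x fin k by (intro card_subset_eq) (simp_all add: card_image)
  have ed': "edges T = (\<lambda>i. {x i, x (par i)}) ` {1..k}"
    using ed simple unfolding im simple_graph_def by blast
  \<comment> \<open>Equal edges with exchanged ends would give
    \<open>i = par j < j = par i < i\<close>.\<close>
  have inj: "inj_on (\<lambda>i. {x i, x (par i)}) {1..k}"
  proof (rule inj_onI)
    fix i j assume ij: "i \<in> {1..k}" "j \<in> {1..k}" "{x i, x (par i)} = {x j, x (par j)}"
    have "par i < i" "par j < j" using ij par by auto
    then have le: "i \<le> k" "j \<le> k" "par i \<le> k" "par j \<le> k" using ij by auto
    have "x i = x j \<or> (x i = x (par j) \<and> x (par i) = x j)" using ij(3) by (auto simp: doubleton_eq_iff)
    then have "i = j \<or> (i = par j \<and> par i = j)" using le inj_on_eq_iff[OF x(1)] by simp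
    then show "i = j" using \<open>par i < i\<close> \<open>par j < j\<close> by auto
  qed
  have "n = k" using n inj by (simp add: ed' card_image)
  then show ?thesis using that[of x par] im x par ed' inj by (simp add: bij_betw_def)
qed

lemma tree_children_le_degree:
  fixes x :: "nat \<Rightarrow> 'a"
  assumes x: "bij_betw x {..n} (verts T)" and par: "\<And>i. i \<in> {1..n} \<Longrightarrow> par i < i"
    and ed: "edges T = (\<lambda>i. {x i, x (par i)}) ` {1..n}" "inj_on (\<lambda>i. {x i, x (par i)}) {1..n}"
    and deg: "\<And>v. v \<in> verts T \<Longrightarrow> degree T v \<le> D"
  shows "card {i \<in> {1..n}. par i = j} \<le> D"
proof (cases "j \<le> n")
  case True
  have "card {i \<in> {1..n}. par i = j} = card ((\<lambda>i. {x i, x (par i)}) ` {i \<in> {1..n}. par i = j})"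
    by (rule card_image[symmetric], rule inj_on_subset[OF ed(2)]) auto
  also have "\<dots> \<le> degree T (x j)"
    unfolding degree_def
  proof (rule card_mono)
    show "finite {e \<in> edges T. x j \<in> e}"
      by (rule finite_subset[of _ "edges T"]) (auto simp: ed(1))
  qed (auto simp: ed(1))
  also have "\<dots> \<le> D" using True x by (intro deg) (auto simp: bij_betw_def)
  finally show ?thesis .
next
  case False
  have "{i \<in> {1..n}. par i = j} = {}" using par False by fastforce
  then show ?thesis by (metis card.empty le0)
qed

lemma contains_copy_tree:
  fixes x :: "nat \<Rightarrow> 'b"
  assumes x: "bij_betw x {..n} (verts T)" and par: "\<And>i. i \<in> {1..n} \<Longrightarrow> par i < i"
    and ed: "edges T = (\<lambda>i. {x i, x (par i)}) ` {1..n}"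
    and g: "inj_on g {..n}" "g ` {..n} \<subseteq> verts G" "\<And>i. i \<in> {1..n} \<Longrightarrow> {g i, g (par i)} \<in> edges G"
  shows "contains_copy G T"
proof -
  define f where "f = g \<circ> the_inv_into {..n} x"
  have inj: "inj_on x {..n}" and im: "verts T = x ` {..n}" using x by (auto simp: bij_betw_def)
  have fx: "f (x i) = g i" if "i \<le> n" for i
    using inj that by (simp add: f_def the_inv_into_f_f)
  have "inj_on f (verts T)" using g(1) by (auto simp: im inj_on_def fx)
  moreover have "f ` verts T \<subseteq> verts G" using g(2) by (auto simp: im fx)
  moreover have "f ` e \<in> edges G" if "e \<in> edges T" for e
  proof -
    have "e \<in> (\<lambda>i. {x i, x (par i)}) ` {1..n}" using that by (simp only: ed)
    then obtain i where i: "i \<in> {1..n}" "e = {x i, x (par i)}" by (rule imageE)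
    then have "f ` e = {g i, g (par i)}" using par[of i] by (auto simp: fx)
    then show ?thesis using g(3) i by simp
  qed
  ultimately show ?thesis unfolding contains_copy_def by blast
qed

section \<open>Janson's inequality\<close>

abbreviation bernoulli_field :: "'e set \<Rightarrow> real \<Rightarrow> ('e \<Rightarrow> bool) pmf" where
  "bernoulli_field E p \<equiv> Pi_pmf E False (\<lambda>_. bernoulli_pmf p)"

lemma finite_set_Pi_bool:
  assumes "finite E"
  shows "finite (set_pmf (Pi_pmf E False (q :: 'e \<Rightarrow> bool pmf)))"
proof -
  have "set_pmf (Pi_pmf E False q) \<subseteq> PiE_dflt E False (set_pmf \<circ> q)"
    using assms by (intro set_Pi_pmf_subset')
  moreover have "finite (PiE_dflt E False (set_pmf \<circ> q))"
    using assms by (intro finite_PiE_dflt) auto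
  ultimately show ?thesis by (rule finite_subset)
qed

lemma integrable_Pi_bool [simp]:
  fixes f :: "('e \<Rightarrow> bool) \<Rightarrow> real"
  assumes "finite E"
  shows "integrable (measure_pmf (Pi_pmf E False q)) f"
  using assms by (intro integrable_measure_pmf_finite finite_set_Pi_bool)

definition all_present :: "'e set \<Rightarrow> ('e \<Rightarrow> bool) \<Rightarrow> real" where
  "all_present S b = of_bool (\<forall>e\<in>S. b e)"

text \<open>Condition on one coordinate: the field on \<open>E\<close> is the field on
  \<open>E - {e}\<close> with an independent Bernoulli value inserted at \<open>e\<close>.\<close>

lemma expectation_present_mult:
  fixes g :: "('e \<Rightarrow> bool) \<Rightarrow> real"
  assumes E: "finite E" "e \<in> E" and p: "0 \<le> p" "p \<le> 1"
    and indep: "\<And>b y. g (b(e := y)) = g b"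
  shows "measure_pmf.expectation (bernoulli_field E p) (\<lambda>b. of_bool (b e) * g b) =
         p * measure_pmf.expectation (bernoulli_field E p) g"
proof -
  define E' where "E' = E - {e}"
  have E': "E = insert e E'" "e \<notin> E'" "finite E'" using E by (auto simp: E'_def)
  define M where "M = bernoulli_field E' p"
  have split: "measure_pmf.expectation (bernoulli_field E p) h =
      p * measure_pmf.expectation M (\<lambda>b. h (b(e := True))) +
      (1 - p) * measure_pmf.expectation M (\<lambda>b. h (b(e := False)))"
    for h :: "('e \<Rightarrow> bool) \<Rightarrow> real"
  proof -
    have fin: "finite (set_pmf M)"
      unfolding M_def using E' by (intro finite_set_Pi_bool)
    have "bernoulli_field E p = bernoulli_pmf p \<bind> (\<lambda>y. map_pmf (\<lambda>b. b(e := y)) M)"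
      unfolding E'(1) M_def using E' by (simp add: Pi_pmf_insert' map_pmf_def)
    then have "measure_pmf.expectation (bernoulli_field E p) h =
      (\<Sum>y\<in>UNIV. pmf (bernoulli_pmf p) y *\<^sub>R measure_pmf.expectation (map_pmf (\<lambda>b. b(e := y)) M) h)"
      using fin by (simp only:) (rule pmf_expectation_bind, auto)
    then show ?thesis using p by (simp add: UNIV_bool)
  qed
  have "measure_pmf.expectation (bernoulli_field E p) g = measure_pmf.expectation M g"
    unfolding split by (simp add: indep algebra_simps)
  then show ?thesis unfolding split[of "\<lambda>b. of_bool (b e) * g b"] by (simp add: indep)
qed

lemma expectation_all_present_mult:
  fixes g :: "('e \<Rightarrow> bool) \<Rightarrow> real"
  assumes E: "finite E" "S \<subseteq> E" and p: "0 \<le> p" "p \<le> 1"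
    and indep: "\<And>b b'. (\<And>e. e \<notin> S \<Longrightarrow> b e = b' e) \<Longrightarrow> g b = g b'"
  shows "measure_pmf.expectation (bernoulli_field E p) (\<lambda>b. all_present S b * g b) =
         p ^ card S * measure_pmf.expectation (bernoulli_field E p) g"
proof -
  have "finite S" using E finite_subset by blast
  then show ?thesis using E(2) indep
  proof (induction S)
    case empty
    then show ?case by (simp add: all_present_def)
  next
    case (insert e S)
    have "(\<lambda>b. all_present (insert e S) b * g b) = (\<lambda>b. of_bool (b e) * (all_present S b * g b))"
      by (auto simp: all_present_def)
    then have "measure_pmf.expectation (bernoulli_field E p) (\<lambda>b. all_present (insert e S) b * g b) =
      measure_pmf.expectation (bernoulli_field E p) (\<lambda>b. of_bool (b e) * (all_present S b * g b))"
      by simp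
    also have "\<dots> = p * measure_pmf.expectation (bernoulli_field E p) (\<lambda>b. all_present S b * g b)"
    proof (rule expectation_present_mult)
      fix b y
      have "g (b(e := y)) = g b" by (rule insert.prems(2)) auto
      moreover have "all_present S (b(e := y)) = all_present S b"
        using insert.hyps by (auto simp: all_present_def)
      ultimately show "all_present S (b(e := y)) * g (b(e := y)) = all_present S b * g b" by simp
    qed (use E insert.prems p in auto)
    also have "measure_pmf.expectation (bernoulli_field E p) (\<lambda>b. all_present S b * g b) =
       p ^ card S * measure_pmf.expectation (bernoulli_field E p) g"
    proof (rule insert.IH)
      show "S \<subseteq> E" using insert.prems(1) by simp
      show "g b = g b'" if "\<And>e. e \<notin> S \<Longrightarrow> b e = b' e" for b b'
        by (rule insert.prems(2), rule that) simp
    qed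
    finally show ?case using insert.hyps by simp
  qed
qed

text \<open>A case of Harris's inequality. When \<open>S\<close> is present, \<open>g\<close> agrees
  with \<open>h\<close>, the value of \<open>g\<close> after switching \<open>S\<close> on. This
  \<open>h\<close> does not depend on the coordinates in \<open>S\<close>, and
  \<open>h \<le> g\<close> because \<open>g\<close> is decreasing.\<close>

lemma expectation_all_present_antimono_le:
  fixes g :: "('e \<Rightarrow> bool) \<Rightarrow> real"
  assumes E: "finite E" "S \<subseteq> E" and p: "0 \<le> p" "p \<le> 1"
    and anti: "\<And>b b'. (\<And>e. b e \<Longrightarrow> b' e) \<Longrightarrow> g b' \<le> g b"
  shows "measure_pmf.expectation (bernoulli_field E p) (\<lambda>b. all_present S b * g b) \<le>
         p ^ card S * measure_pmf.expectation (bernoulli_field E p) g"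
proof -
  define h where "h b = g (\<lambda>e. b e \<or> e \<in> S)" for b
  have "(\<lambda>b. all_present S b * g b) = (\<lambda>b. all_present S b * h b)"
  proof
    fix b
    show "all_present S b * g b = all_present S b * h b"
    proof (cases "\<forall>e\<in>S. b e")
      case True
      then have "(\<lambda>e. b e \<or> e \<in> S) = b" by auto
      then show ?thesis by (simp add: h_def)
    qed (simp add: all_present_def)
  qed
  then have "measure_pmf.expectation (bernoulli_field E p) (\<lambda>b. all_present S b * g b) =
      measure_pmf.expectation (bernoulli_field E p) (\<lambda>b. all_present S b * h b)" by simp
  also have "\<dots> = p ^ card S * measure_pmf.expectation (bernoulli_field E p) h"
  proof (rule expectation_all_present_mult[OF E p])
    fix b b' :: "'e \<Rightarrow> bool" assume "\<And>e. e \<notin> S \<Longrightarrow> b e = b' e"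
    then have "(\<lambda>e. b e \<or> e \<in> S) = (\<lambda>e. b' e \<or> e \<in> S)" by auto
    then show "h b = h b'" by (simp add: h_def)
  qed
  also have "\<dots> \<le> p ^ card S * measure_pmf.expectation (bernoulli_field E p) g"
    using p E by (intro mult_left_mono integral_mono) (auto simp: h_def intro: anti)
  finally show ?thesis .
qed

text \<open>The weight \<^term>\<open>q\<close> plays the role of the random thinning in the usual derivation of the bound
  with a quadratic numerator: choosing \<^term>\<open>q\<close> proportional to \<^term>\<open>\<mu> / \<Delta>\<close> gives it directly.\<close>

lemma janson_product_bound:
  fixes S :: "'i \<Rightarrow> 'e set" and p q :: real
  assumes E: "finite E" and p: "0 \<le> p" "p \<le> 1" and q: "0 \<le> q" "q \<le> 1"
    and I: "finite I" and SE: "\<And>i. i \<in> I \<Longrightarrow> S i \<subseteq> E"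
  shows "measure_pmf.expectation (bernoulli_field E p) (\<lambda>b. \<Prod>i\<in>I. 1 - q * all_present (S i) b) \<le>
    exp (- q * (\<Sum>i\<in>I. p ^ card (S i)) +
         q\<^sup>2 * (\<Sum>i\<in>I. \<Sum>j | j \<in> I \<and> S i \<inter> S j \<noteq> {}. p ^ card (S i \<union> S j)))"
  using I SE
proof (induction I)
  case empty
  then show ?case by simp
next
  case (insert i I)
  define Ex :: "(('e \<Rightarrow> bool) \<Rightarrow> real) \<Rightarrow> real"
    where "Ex = measure_pmf.expectation (bernoulli_field E p)"
  define g where "g J b = (\<Prod>j\<in>J. 1 - q * all_present (S j) b)" for J b
  \<comment> \<open>The product over \<open>I0\<close> is independent of the presence of
    \<open>S i\<close>; the sets in \<open>I1\<close> produce the correction \<Delta>.\<close>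
  define I0 where "I0 = {j \<in> I. S i \<inter> S j = {}}"
  define I1 where "I1 = {j \<in> I. S i \<inter> S j \<noteq> {}}"
  have I01: "I = I0 \<union> I1" "I0 \<inter> I1 = {}" "finite I0" "finite I1"
    using insert.hyps by (auto simp: I0_def I1_def)
  have ap: "0 \<le> all_present T b" "all_present T b \<le> 1" for T and b :: "'e \<Rightarrow> bool"
    by (auto simp: all_present_def)
  have qap: "0 \<le> q * all_present T b" "q * all_present T b \<le> 1" for T and b :: "'e \<Rightarrow> bool"
    using q ap[of T b] by (auto intro: mult_le_one)
  have g01: "0 \<le> g J b" "g J b \<le> 1" for J b
    unfolding g_def using qap by (auto intro!: prod_nonneg prod_le_1)
  have anti: "g J b' \<le> g J b" if "\<And>e. b e \<Longrightarrow> b' e" for J b b'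
    unfolding g_def
  proof (intro prod_mono conjI)
    fix j assume "j \<in> J"
    show "0 \<le> 1 - q * all_present (S j) b'" using qap by simp
    have "all_present (S j) b \<le> all_present (S j) b'" using that by (auto simp: all_present_def)
    then show "1 - q * all_present (S j) b' \<le> 1 - q * all_present (S j) b"
      using q by (simp add: mult_left_mono)
  qed
  have gsplit: "g I b = g I0 b * g I1 b" for b
    unfolding g_def I01(1) using I01 by (intro prod.union_disjoint) auto
  have Ex_mono: "Ex f \<le> Ex f'" if "\<And>b. f b \<le> f' b" for f f'
    unfolding Ex_def using that E by (intro integral_mono) auto
  have Ex_nonneg: "0 \<le> Ex f" if "\<And>b. 0 \<le> f b" for f
    unfolding Ex_def using that by (intro integral_nonneg_AE) auto
  define \<Delta> where "\<Delta> = (\<Sum>j\<in>I1. p ^ card (S i \<union> S j))"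
  have Si: "S i \<subseteq> E" using insert.prems by simp
  have indep: "Ex (\<lambda>b. all_present (S i) b * g I0 b) = p ^ card (S i) * Ex (g I0)"
    unfolding Ex_def
  proof (rule expectation_all_present_mult[OF E Si p])
    fix b b' :: "'e \<Rightarrow> bool" assume eq: "\<And>e. e \<notin> S i \<Longrightarrow> b e = b' e"
    have "all_present (S j) b = all_present (S j) b'" if "j \<in> I0" for j
    proof -
      have "b e = b' e" if "e \<in> S j" for e using eq[of e] \<open>j \<in> I0\<close> that by (auto simp: I0_def)
      then show ?thesis by (simp add: all_present_def)
    qed
    then show "g I0 b = g I0 b'" unfolding g_def by (intro prod.cong) auto
  qed
  have pair: "Ex (\<lambda>b. all_present (S i) b * all_present (S j) b * g I0 b) \<le> p ^ card (S i \<union> S j) * Ex (g I0)"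
    if "j \<in> I1" for j
  proof -
    have "(\<lambda>b. all_present (S i) b * all_present (S j) b * g I0 b) =
      (\<lambda>b. all_present (S i \<union> S j) b * g I0 b)" by (rule ext) (auto simp: all_present_def)
    moreover have "S i \<union> S j \<subseteq> E" using insert.prems that by (auto simp: I1_def)
    then have "Ex (\<lambda>b. all_present (S i \<union> S j) b * g I0 b) \<le> p ^ card (S i \<union> S j) * Ex (g I0)"
      unfolding Ex_def by (rule expectation_all_present_antimono_le[OF E _ p anti])
    ultimately show ?thesis by (simp only:)
  qed
  \<comment> \<open>The factors from \<open>I1\<close> are bounded below linearly by the Weierstrass
    product inequality; then \<open>indep\<close> evaluates the main term and \<open>pair\<close>
    bounds the others. This gives the claim with \<open>Ex (g I0)\<close>. Replacing it by the
    smaller \<open>Ex (g I)\<close> needs a nonnegative bracket; for a negative bracket the left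
    side is at most 0.\<close>
  have key: "Ex (g I) * (p ^ card (S i) - q * \<Delta>) \<le> Ex (\<lambda>b. all_present (S i) b * g I b)"
  proof -
    have "Ex (\<lambda>b. all_present (S i) b * g I0 b * (1 - (\<Sum>j\<in>I1. q * all_present (S j) b)))
        \<le> Ex (\<lambda>b. all_present (S i) b * g I b)"
    proof (rule Ex_mono)
      fix b
      have "1 - (\<Sum>j\<in>I1. q * all_present (S j) b) \<le> g I1 b"
        unfolding g_def using qap I01 by (intro Weierstrass_prod_ineq) auto
      then show "all_present (S i) b * g I0 b * (1 - (\<Sum>j\<in>I1. q * all_present (S j) b))
         \<le> all_present (S i) b * g I b"
        unfolding gsplit using ap g01 by (simp add: mult_left_mono mult.assoc)
    qed
    also have "Ex (\<lambda>b. all_present (S i) b * g I0 b * (1 - (\<Sum>j\<in>I1. q * all_present (S j) b))) =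
       Ex (\<lambda>b. all_present (S i) b * g I0 b -
          (\<Sum>j\<in>I1. q * (all_present (S i) b * all_present (S j) b * g I0 b)))"
      by (intro arg_cong[of _ _ Ex] ext) (simp add: right_diff_distrib sum_distrib_left mult_ac)
    also have "\<dots> = Ex (\<lambda>b. all_present (S i) b * g I0 b) -
          (\<Sum>j\<in>I1. q * Ex (\<lambda>b. all_present (S i) b * all_present (S j) b * g I0 b))"
      unfolding Ex_def using E by (simp add: Bochner_Integration.integral_sum)
    finally have "p ^ card (S i) * Ex (g I0) -
        (\<Sum>j\<in>I1. q * Ex (\<lambda>b. all_present (S i) b * all_present (S j) b * g I0 b))
        \<le> Ex (\<lambda>b. all_present (S i) b * g I b)" by (simp add: indep)
    moreover have "(\<Sum>j\<in>I1. q * Ex (\<lambda>b. all_present (S i) b * all_present (S j) b * g I0 b)) \<le>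
       (\<Sum>j\<in>I1. q * (p ^ card (S i \<union> S j) * Ex (g I0)))"
      using pair q by (intro sum_mono mult_left_mono) auto
    moreover have "(\<Sum>j\<in>I1. q * (p ^ card (S i \<union> S j) * Ex (g I0))) = q * \<Delta> * Ex (g I0)"
      by (simp add: \<Delta>_def sum_distrib_left sum_distrib_right mult.assoc)
    ultimately have main: "Ex (g I0) * (p ^ card (S i) - q * \<Delta>) \<le> Ex (\<lambda>b. all_present (S i) b * g I b)"
      by (simp add: algebra_simps)
    show ?thesis
    proof (cases "p ^ card (S i) - q * \<Delta> \<ge> 0")
      case True
      have "Ex (g I) \<le> Ex (g I0)"
        unfolding gsplit using g01 by (intro Ex_mono) (simp add: mult_left_le)
      from mult_right_mono[OF this True] main show ?thesis by linarith
    next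
      case False
      have "0 \<le> Ex (g I)" "0 \<le> Ex (\<lambda>b. all_present (S i) b * g I b)"
        using g01 ap by (auto intro!: Ex_nonneg)
      then show ?thesis
        using False mult_nonneg_nonpos[of "Ex (g I)" "p ^ card (S i) - q * \<Delta>"] by linarith
    qed
  qed
  define \<mu>' where "\<mu>' J = (\<Sum>i\<in>J. p ^ card (S i))" for J
  define \<Delta>' where "\<Delta>' J = (\<Sum>i\<in>J. \<Sum>j | j \<in> J \<and> S i \<inter> S j \<noteq> {}. p ^ card (S i \<union> S j))" for J
  have "Ex (g (insert i I)) = Ex (\<lambda>b. g I b - q * (all_present (S i) b * g I b))"
    unfolding g_def using insert.hyps by (intro arg_cong[of _ _ Ex] ext) (simp add: left_diff_distrib)
  also have "\<dots> = Ex (g I) - q * Ex (\<lambda>b. all_present (S i) b * g I b)"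
    unfolding Ex_def using E by simp
  also have "\<dots> \<le> Ex (g I) - q * (Ex (g I) * (p ^ card (S i) - q * \<Delta>))"
    using key q by (simp add: mult_left_mono)
  also have "\<dots> = Ex (g I) * (1 + (- q * p ^ card (S i) + q\<^sup>2 * \<Delta>))"
    by (simp add: algebra_simps power2_eq_square)
  \<comment> \<open>The bound \<open>1 + x \<le> exp x\<close> turns the recursion into a sum of
    exponents.\<close>
  also have "\<dots> \<le> Ex (g I) * exp (- q * p ^ card (S i) + q\<^sup>2 * \<Delta>)"
    by (intro mult_left_mono exp_ge_add_one_self Ex_nonneg g01)
  also have "\<dots> \<le> exp (- q * \<mu>' I + q\<^sup>2 * \<Delta>' I) * exp (- q * p ^ card (S i) + q\<^sup>2 * \<Delta>)"
    using insert unfolding Ex_def g_def \<mu>'_def \<Delta>'_def by (intro mult_right_mono) auto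
  also have "\<dots> = exp (- q * \<mu>' (insert i I) + q\<^sup>2 * (\<Delta>' I + \<Delta>))"
    using insert.hyps by (simp add: \<mu>'_def algebra_simps flip: exp_add)
  also have "\<dots> \<le> exp (- q * \<mu>' (insert i I) + q\<^sup>2 * \<Delta>' (insert i I))"
  proof -
    \<comment> \<open>The double sum runs over ordered pairs, so inserting \<open>i\<close> adds at
      least \<Delta>; the remaining new terms are nonnegative.\<close>
    have "\<Delta>' I \<le> (\<Sum>k\<in>I. \<Sum>j | j \<in> insert i I \<and> S k \<inter> S j \<noteq> {}. p ^ card (S k \<union> S j))"
      unfolding \<Delta>'_def using insert.hyps p by (intro sum_mono sum_mono2) auto
    moreover have "\<Delta> \<le> (\<Sum>j | j \<in> insert i I \<and> S i \<inter> S j \<noteq> {}. p ^ card (S i \<union> S j))"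
      unfolding \<Delta>_def I1_def using insert.hyps p by (intro sum_mono2) auto
    ultimately have "\<Delta>' I + \<Delta> \<le> \<Delta>' (insert i I)"
      unfolding \<Delta>'_def using insert.hyps by simp
    then show ?thesis using q by (simp add: mult_left_mono)
  qed
  finally show ?case unfolding Ex_def g_def \<mu>'_def \<Delta>'_def .
qed

text \<open>The product dominates the indicator of the event: all factors are 1 when no
  \<open>S i\<close> is present, and they are nonnegative in any case since
  \<open>q \<le> 1\<close>.\<close>

lemma janson_inequality:
  fixes S :: "'i \<Rightarrow> 'e set" and p q :: real
  assumes E: "finite E" and p: "0 \<le> p" "p \<le> 1" and q: "0 \<le> q" "q \<le> 1"
    and I: "finite I" and SE: "\<And>i. i \<in> I \<Longrightarrow> S i \<subseteq> E"
  shows "measure_pmf.prob (bernoulli_field E p) {b. \<forall>i\<in>I. \<not> (\<forall>e\<in>S i. b e)} \<le>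
    exp (- q * (\<Sum>i\<in>I. p ^ card (S i)) +
         q\<^sup>2 * (\<Sum>i\<in>I. \<Sum>j | j \<in> I \<and> S i \<inter> S j \<noteq> {}. p ^ card (S i \<union> S j)))"
proof -
  define A where "A = {b. \<forall>i\<in>I. \<not> (\<forall>e\<in>S i. b e)}"
  have "measure_pmf.prob (bernoulli_field E p) A = measure_pmf.expectation (bernoulli_field E p) (indicator A)"
    by simp
  also have "\<dots> \<le> measure_pmf.expectation (bernoulli_field E p) (\<lambda>b. \<Prod>i\<in>I. 1 - q * all_present (S i) b)"
  proof (intro integral_mono)
    fix b
    show "indicator A b \<le> (\<Prod>i\<in>I. 1 - q * all_present (S i) b)"
    proof (cases "b \<in> A")
      case True
      then have "(\<Prod>i\<in>I. 1 - q * all_present (S i) b) = (\<Prod>i\<in>I. 1)"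
        by (intro prod.cong) (auto simp: A_def all_present_def)
      then show ?thesis by simp
    next
      case False
      then show ?thesis using q by (auto intro!: prod_nonneg simp: all_present_def)
    qed
  qed (use E in auto)
  also note janson_product_bound[OF E p q I SE]
  finally show ?thesis by (simp add: A_def)
qed

section \<open>Transversal cliques\<close>

definition clique_edges :: "nat \<Rightarrow> (nat \<Rightarrow> 'v) \<Rightarrow> 'v set set" where
  "clique_edges s v = (\<lambda>e. v ` e) ` {e. e \<subseteq> {..<s} \<and> card e = 2}"

locale disjoint_classes =
  fixes s m :: nat and V :: "nat \<Rightarrow> 'v set"
  assumes disj: "\<And>i j. i < s \<Longrightarrow> j < s \<Longrightarrow> i \<noteq> j \<Longrightarrow> V i \<inter> V j = {}"
    and fin_class: "\<And>i. i < s \<Longrightarrow> finite (V i)"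
    and card_class: "\<And>i. i < s \<Longrightarrow> card (V i) = m"
begin

abbreviation "transversals \<equiv> PiE {..<s} V"

definition agree :: "(nat \<Rightarrow> 'v) \<Rightarrow> (nat \<Rightarrow> 'v) \<Rightarrow> nat set" where
  "agree v w = {i. i < s \<and> v i = w i}"

lemma finite_transversals: "finite transversals"
  by (intro finite_PiE) (auto intro: fin_class)

lemma card_transversals: "card transversals = m ^ s"
proof -
  have "(\<Prod>i<s. card (V i)) = (\<Prod>i<s. m)" by (rule prod.cong) (auto simp: card_class)
  then show ?thesis by (simp add: card_PiE)
qed

lemma transversal_eqD:
  assumes "v \<in> transversals" "w \<in> transversals" "i < s" "j < s" "v i = w j"
  shows "i = j"
proof (rule ccontr)
  assume "i \<noteq> j"
  then have "V i \<inter> V j = {}" using assms(3,4) by (intro disj)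
  moreover have "v i \<in> V i" "w j \<in> V j" using assms(1-4) by (auto intro: PiE_mem)
  ultimately show False unfolding assms(5) by blast
qed

lemma transversal_inj: "v \<in> transversals \<Longrightarrow> inj_on v {..<s}"
  by (rule inj_onI) (auto intro: transversal_eqD)

text \<open>A vertex determines the index of its class, so a common edge of two transversal cliques
  comes from the same pair of indices in both.\<close>

lemma transversal_image_eqD:
  assumes "v \<in> transversals" "w \<in> transversals" "e \<subseteq> {..<s}" "e' \<subseteq> {..<s}" "v ` e = w ` e'"
  shows "e = e'" "e \<subseteq> agree v w"
proof -
  have *: "i \<in> e' \<and> v i = w i" if "i \<in> e" for i
  proof -
    have "v i \<in> w ` e'" using assms(5) that by auto
    then obtain j where j: "j \<in> e'" "v i = w j" by auto
    then have "i = j" using assms that by (intro transversal_eqD[of v w i j]) auto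
    then show ?thesis using j by simp
  qed
  have "i \<in> e" if "i \<in> e'" for i
  proof -
    have "w i \<in> v ` e" using assms(5) that by auto
    then obtain j where j: "j \<in> e" "w i = v j" by auto
    then have "j = i" using assms that by (intro transversal_eqD[of v w j i]) auto
    then show ?thesis using j by simp
  qed
  then show "e = e'" "e \<subseteq> agree v w" using * assms(3) by (auto simp: agree_def)
qed

lemma inj_on_image_pairs: "v \<in> transversals \<Longrightarrow> inj_on ((`) v) {e. e \<subseteq> {..<s} \<and> card e = 2}"
  by (rule inj_onI, rule transversal_image_eqD(1)) auto

lemma finite_pairs: "finite {e. e \<subseteq> {..<s::nat} \<and> card e = 2}"
  by (rule finite_subset[of _ "Pow {..<s}"]) auto

lemma card_clique_edges: "v \<in> transversals \<Longrightarrow> card (clique_edges s v) = s choose 2"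
  unfolding clique_edges_def
  by (subst card_image[OF inj_on_image_pairs]) (auto simp: n_subsets)

lemma clique_edges_Int:
  assumes "v \<in> transversals" "w \<in> transversals"
  shows "card (clique_edges s v \<inter> clique_edges s w) = card (agree v w) choose 2"
proof -
  have sub: "agree v w \<subseteq> {..<s}" by (auto simp: agree_def)
  have im: "v ` e = w ` e" if "e \<subseteq> agree v w" for e
    using that by (intro image_cong) (auto simp: agree_def)
  have "clique_edges s v \<inter> clique_edges s w = (`) v ` {e. e \<subseteq> agree v w \<and> card e = 2}"
  proof (intro equalityI subsetI)
    fix x assume "x \<in> clique_edges s v \<inter> clique_edges s w"
    then obtain e e' where e: "e \<subseteq> {..<s}" "card e = 2" "x = v ` e" "e' \<subseteq> {..<s}" "x = w ` e'"
      by (auto simp: clique_edges_def)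
    then have "e \<subseteq> agree v w" using transversal_image_eqD(2)[OF assms e(1) e(4)] by simp
    then show "x \<in> (`) v ` {e. e \<subseteq> agree v w \<and> card e = 2}" using e by auto
  next
    fix x assume "x \<in> (`) v ` {e. e \<subseteq> agree v w \<and> card e = 2}"
    then obtain e where e: "e \<subseteq> agree v w" "card e = 2" "x = v ` e" by auto
    then have "e \<subseteq> {..<s}" "x = w ` e" using sub im by auto
    then show "x \<in> clique_edges s v \<inter> clique_edges s w"
      using e(2,3) unfolding clique_edges_def by blast
  qed
  also have "card \<dots> = card {e. e \<subseteq> agree v w \<and> card e = 2}"
    using inj_on_image_pairs[OF assms(1)] sub
    by (intro card_image) (auto elim!: inj_on_subset)
  finally show ?thesis using sub by (simp add: n_subsets finite_subset)
qed

lemma card_clique_edges_Un: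
  assumes "v \<in> transversals" "w \<in> transversals"
  shows "card (clique_edges s v \<union> clique_edges s w) = 2 * (s choose 2) - (card (agree v w) choose 2)"
proof -
  have "finite (clique_edges s v)" "finite (clique_edges s w)"
    using finite_pairs by (auto simp: clique_edges_def)
  then show ?thesis
    using card_Un_Int[of "clique_edges s v" "clique_edges s w"] assms
    by (simp add: card_clique_edges clique_edges_Int)
qed

lemma card_agree_le:
  assumes "v \<in> transversals" "K \<subseteq> {..<s}"
  shows "card {w \<in> transversals. agree v w = K} \<le> m ^ (s - card K)"
proof -
  have "{w \<in> transversals. agree v w = K} \<subseteq> PiE {..<s} (\<lambda>i. if i \<in> K then {v i} else V i)"
  proof
    fix w assume "w \<in> {w \<in> transversals. agree v w = K}"
    then have w: "w \<in> transversals" "agree v w = K" by auto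
    show "w \<in> PiE {..<s} (\<lambda>i. if i \<in> K then {v i} else V i)"
    proof (rule PiE_I)
      fix i assume "i \<in> {..<s}"
      then show "w i \<in> (if i \<in> K then {v i} else V i)"
        using PiE_mem[OF w(1), of i] w(2) by (auto simp: agree_def)
    qed (use PiE_arb[OF w(1)] in simp)
  qed
  then have "card {w \<in> transversals. agree v w = K} \<le> card (PiE {..<s} (\<lambda>i. if i \<in> K then {v i} else V i))"
    by (intro card_mono finite_PiE) (auto intro: fin_class)
  also have "\<dots> = (\<Prod>i<s. if i \<in> K then 1 else m)"
    by (subst card_PiE) (auto intro!: prod.cong simp: card_class)
  also have "\<dots> = (\<Prod>i\<in>{..<s} - K. m)"
    by (rule prod.mono_neutral_cong_right) auto
  also have "\<dots> = m ^ (s - card K)"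
    using assms(2) by (simp add: card_Diff_subset finite_subset)
  finally show ?thesis .
qed

text \<open>Group the transversals \<open>w\<close> by the set \<open>K\<close> of indices where
  they agree with \<open>v\<close>; a shared edge means \<open>k = card K \<ge> 2\<close>. There are
  at most \<open>m ^ (s - k)\<close> such \<open>w\<close>, and relative to
  \<open>m ^ s * p ^ (2 * c)\<close> their contribution saves the factor
  \<open>m ^ k * p ^ (k choose 2)\<close>, which is at least \<open>a\<close>. There are at most
  \<open>2 ^ s\<close> sets \<open>K\<close>.\<close>

lemma sum_intersecting_le:
  fixes p a :: real
  assumes v: "v \<in> transversals" and p: "0 \<le> p" and a: "a > 0"
    and dense: "\<And>k. 2 \<le> k \<Longrightarrow> k \<le> s \<Longrightarrow> a \<le> m ^ k * p ^ (k choose 2)"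
  shows "(\<Sum>w | w \<in> transversals \<and> clique_edges s v \<inter> clique_edges s w \<noteq> {}.
      p ^ card (clique_edges s v \<union> clique_edges s w)) \<le> 2 ^ s * (m ^ s * p ^ (2 * (s choose 2)) / a)"
proof -
  define c where "c = s choose 2"
  define f where "f k = p ^ (2 * c - (k choose 2))" for k
  define \<K> where "\<K> = {K. K \<subseteq> {..<s} \<and> 2 \<le> card K}"
  define W where "W = {w \<in> transversals. 2 \<le> card (agree v w)}"
  have finK: "finite \<K>" unfolding \<K>_def by (rule finite_subset[of _ "Pow {..<s}"]) auto
  have cK: "card \<K> \<le> 2 ^ s"
    using card_mono[of "Pow {..<s}" \<K>] by (auto simp: \<K>_def card_Pow)
  have finW: "finite W" using finite_transversals by (auto simp: W_def)
  have "2 \<le> card (agree v w)" if "w \<in> transversals" "clique_edges s v \<inter> clique_edges s w \<noteq> {}" for w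
  proof -
    have "finite (clique_edges s v \<inter> clique_edges s w)"
      using finite_pairs by (auto simp: clique_edges_def)
    then have "card (agree v w) choose 2 > 0"
      using that clique_edges_Int[OF v that(1)] by (metis card_gt_0_iff)
    then show ?thesis by (simp only: zero_less_binomial_iff)
  qed
  then have "(\<Sum>w | w \<in> transversals \<and> clique_edges s v \<inter> clique_edges s w \<noteq> {}.
      p ^ card (clique_edges s v \<union> clique_edges s w)) \<le>
      (\<Sum>w\<in>W. p ^ card (clique_edges s v \<union> clique_edges s w))"
    using finW p by (intro sum_mono2) (auto simp: W_def)
  also have "\<dots> = (\<Sum>w\<in>W. f (card (agree v w)))"
    by (intro sum.cong) (simp_all add: W_def f_def c_def card_clique_edges_Un[OF v])
  also have "\<dots> = (\<Sum>K\<in>\<K>. \<Sum>w | w \<in> W \<and> agree v w = K. f (card (agree v w)))"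
    by (rule sum.group[symmetric]) (use finW finK in \<open>auto simp: W_def \<K>_def agree_def\<close>)
  also have "\<dots> \<le> (\<Sum>K\<in>\<K>. m ^ s * p ^ (2 * c) / a)"
  proof (rule sum_mono)
    fix K assume K: "K \<in> \<K>"
    define k where "k = card K"
    have k: "2 \<le> k" "k \<le> s" using K card_mono[of "{..<s}" K] by (auto simp: \<K>_def k_def)
    have "k choose 2 \<le> c" unfolding c_def using k(2) by (rule binomial_right_mono)
    then have e: "2 * c = (2 * c - (k choose 2)) + (k choose 2)" by simp
    have "(\<Sum>w | w \<in> W \<and> agree v w = K. f (card (agree v w))) = card {w \<in> W. agree v w = K} * f k"
      by (simp add: k_def)
    also have "\<dots> \<le> m ^ (s - k) * f k"
    proof -
      have "{w \<in> W. agree v w = K} \<subseteq> {w \<in> transversals. agree v w = K}" by (auto simp: W_def)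
      then have "card {w \<in> W. agree v w = K} \<le> card {w \<in> transversals. agree v w = K}"
        using finite_transversals by (intro card_mono) auto
      also have "\<dots> \<le> m ^ (s - k)" using card_agree_le[OF v] K by (simp add: \<K>_def k_def)
      finally have "real (card {w \<in> W. agree v w = K}) \<le> real (m ^ (s - k))" by (rule of_nat_mono)
      then show ?thesis using p by (simp add: f_def mult_right_mono)
    qed
    also have "m ^ (s - k) * f k \<le> m ^ s * p ^ (2 * c) / a"
    proof -
      have "m ^ (s - k) * f k * a \<le> m ^ (s - k) * f k * (m ^ k * p ^ (k choose 2))"
        using dense[OF k] p by (intro mult_left_mono) (auto simp: f_def)
      also have "\<dots> = (real m ^ (s - k) * real m ^ k) * (p ^ (2 * c - (k choose 2)) * p ^ (k choose 2))"
        by (simp add: f_def mult_ac)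
      also have "\<dots> = m ^ s * p ^ (2 * c)"
        using k e by (simp flip: power_add)
      finally show ?thesis using a by (simp add: pos_le_divide_eq)
    qed
    finally show "(\<Sum>w | w \<in> W \<and> agree v w = K. f (card (agree v w))) \<le> m ^ s * p ^ (2 * c) / a" .
  qed
  also have "\<dots> = card \<K> * (m ^ s * p ^ (2 * c) / a)" by simp
  also have "\<dots> \<le> 2 ^ s * (m ^ s * p ^ (2 * c) / a)"
  proof (rule mult_right_mono)
    show "real (card \<K>) \<le> 2 ^ s" using cK by (metis of_nat_le_iff of_nat_numeral of_nat_power)
  qed (use p a in auto)
  finally show ?thesis by (simp add: c_def)
qed

text \<open>Janson's inequality with \<open>\<Delta> \<le> 2 ^ s * \<mu>\<^sup>2 / a\<close>. The
  chosen \<open>q\<close> minimises the resulting quadratic exponent, whose minimum is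
  \<open>- a / 2 ^ (s + 2)\<close>; it is at most 1 because \<open>dense\<close> at
  \<open>k = s\<close> says \<open>a \<le> \<mu>\<close>.\<close>

lemma prob_no_transversal_clique:
  fixes p a :: real and E :: "'v set set"
  assumes E: "finite E" "\<And>v. v \<in> transversals \<Longrightarrow> clique_edges s v \<subseteq> E"
    and s: "2 \<le> s" and p: "0 \<le> p" "p \<le> 1" and a: "a > 0"
    and dense: "\<And>k. 2 \<le> k \<Longrightarrow> k \<le> s \<Longrightarrow> a \<le> m ^ k * p ^ (k choose 2)"
  shows "measure_pmf.prob (bernoulli_field E p)
     {b. \<forall>v\<in>transversals. \<not> (\<forall>e\<in>clique_edges s v. b e)} \<le> exp (- a / 2 ^ (s + 2))"
proof -
  define \<mu> where "\<mu> = m ^ s * p ^ (s choose 2)"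
  define q where "q = a / (2 ^ (s + 1) * \<mu>)"
  define \<Delta> where "\<Delta> = (\<Sum>v\<in>transversals. \<Sum>w | w \<in> transversals \<and> clique_edges s v \<inter> clique_edges s w \<noteq> {}.
      p ^ card (clique_edges s v \<union> clique_edges s w))"
  have \<mu>: "a \<le> \<mu>" "\<mu> > 0" using dense[of s] s a by (auto simp: \<mu>_def)
  have "a \<le> 2 ^ (s + 1) * \<mu>"
    using \<mu> mult_right_mono[OF one_le_power[of "2 :: real" "s + 1"], of \<mu>] by linarith
  then have q: "0 \<le> q" "q \<le> 1" using a \<mu> by (auto simp: q_def)
  have "(\<Sum>v\<in>transversals. p ^ card (clique_edges s v)) = (\<Sum>v\<in>transversals. p ^ (s choose 2))"
    by (intro sum.cong) (simp_all add: card_clique_edges)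
  then have sum\<mu>: "(\<Sum>v\<in>transversals. p ^ card (clique_edges s v)) = \<mu>"
    by (simp add: card_transversals \<mu>_def)
  have "\<Delta> \<le> (\<Sum>v\<in>transversals. 2 ^ s * (m ^ s * p ^ (2 * (s choose 2)) / a))"
    unfolding \<Delta>_def by (intro sum_mono sum_intersecting_le p a dense)
  also have "\<dots> = 2 ^ s * \<mu>\<^sup>2 / a"
    by (simp add: card_transversals \<mu>_def power2_eq_square power_add mult_2)
  finally have "q\<^sup>2 * \<Delta> \<le> q\<^sup>2 * (2 ^ s * \<mu>\<^sup>2 / a)" by (rule mult_left_mono) simp
  also have "\<dots> = a / 2 ^ (s + 2)"
    using \<mu> a by (simp add: q_def power2_eq_square field_simps)
  finally have d: "q\<^sup>2 * \<Delta> \<le> a / 2 ^ (s + 2)" .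
  have "q * \<mu> = 2 * (a / 2 ^ (s + 2))" using \<mu> by (simp add: q_def)
  then have "- q * \<mu> + q\<^sup>2 * \<Delta> \<le> - a / 2 ^ (s + 2)" using d by simp
  moreover have "measure_pmf.prob (bernoulli_field E p)
     {b. \<forall>v\<in>transversals. \<not> (\<forall>e\<in>clique_edges s v. b e)} \<le> exp (- q * \<mu> + q\<^sup>2 * \<Delta>)"
    using janson_inequality[OF E(1) p q finite_transversals, of "clique_edges s"] E(2) by (simp only: sum\<mu> \<Delta>_def)
  ultimately show ?thesis by (meson exp_le_cancel_iff order_trans)
qed

end

section \<open>Random graphs\<close>

text \<open>If \<open>r + 1\<close> classes were separated in red, the transversal clique of
  \<open>G\<close> across them would be entirely blue. So a colouring without a blue clique admits
  no such family, and the embedding lemma finds each tree in red inside \<open>W\<close>.\<close>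

lemma arrows_of_transversal_cliques:
  assumes W: "finite W" "W \<subseteq> verts G" and m: "m \<ge> 1"
    and size: "r * (n + (2 * D + 4) * m) + m \<le> card W"
    and cliques: "\<And>X. (\<And>i. i < r + 1 \<Longrightarrow> X i \<subseteq> W \<and> card (X i) = m) \<Longrightarrow>
      (\<And>i j. i < r + 1 \<Longrightarrow> j < r + 1 \<Longrightarrow> i \<noteq> j \<Longrightarrow> X i \<inter> X j = {}) \<Longrightarrow>
      \<exists>v\<in>PiE {..<r + 1} X. clique_edges (r + 1) v \<subseteq> edges G"
  shows "arrows G (complete_graph {..<r + 1}) (trees n D)"
  unfolding arrows_def
proof (intro allI disjCI ballI)
  fix c T
  assume "\<not> (\<forall>T\<in>trees n D. contains_copy (colour_class G c Red) T)"
  show "contains_copy (colour_class G c Blue) (complete_graph {..<r + 1})"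
  proof (rule ccontr)
    assume nb: "\<not> contains_copy (colour_class G c Blue) (complete_graph {..<r + 1})"
    define N where "N x = {y. {x, y} \<in> edges (colour_class G c Red)}" for x
    have sym: "y \<in> N x \<longleftrightarrow> x \<in> N y" for x y by (simp add: N_def insert_commute)
    have nosep: "\<nexists>X. separated_sets N W m (Suc r) X"
    proof
      assume "\<exists>X. separated_sets N W m (Suc r) X"
      then obtain X where X: "separated_sets N W m (Suc r) X" by blast
      have X1: "X i \<subseteq> W \<and> card (X i) = m" if "i < r + 1" for i
        using X that by (simp add: separated_sets_def)
      have X2: "X i \<inter> X j = {}" if "i < r + 1" "j < r + 1" "i \<noteq> j" for i j
        using X that by (simp add: separated_sets_def)
      have X3: "\<Union>(N ` X i) \<inter> X j = {}" if "i < r + 1" "j < r + 1" "i \<noteq> j" for i j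
        using X that by (simp add: separated_sets_def)
      have "\<exists>v\<in>PiE {..<r + 1} X. clique_edges (r + 1) v \<subseteq> edges G"
        by (rule cliques) (use X1 X2 in blast)+
      then obtain v where v: "v \<in> PiE {..<r + 1} X" "clique_edges (r + 1) v \<subseteq> edges G"
        by blast
      have vX: "v i \<in> X i" if "i < r + 1" for i using v(1) that by (auto intro: PiE_mem)
      have "inj_on v {..<r + 1}"
      proof (rule inj_onI, rule ccontr)
        fix i j assume "i \<in> {..<r + 1}" "j \<in> {..<r + 1}" "v i = v j" "i \<noteq> j"
        then show False using X2[of i j] vX[of i] vX[of j] by auto
      qed
      moreover have "v ` {..<r + 1} \<subseteq> verts G" using vX X1 W(2) by blast
      moreover have "v ` e \<in> edges (colour_class G c Blue)" if e: "e \<subseteq> {..<r + 1}" "card e = 2" for e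
      proof -
        have eG: "v ` e \<in> edges G" using v(2) e by (auto simp: clique_edges_def)
        obtain i j where ij: "e = {i, j}" "i \<noteq> j" using e(2) by (auto simp: card_2_iff)
        then have "i < r + 1" "j < r + 1" using e(1) by auto
        then have "v j \<notin> N (v i)" using X3[of i j] ij(2) vX[of i] vX[of j] by blast
        then have "c (v ` e) \<noteq> Red" using eG by (simp add: N_def colour_class_def ij(1))
        then show ?thesis using eG colour.exhaust[of "c (v ` e)"] by (auto simp: colour_class_def)
      qed
      ultimately have "contains_copy (colour_class G c Blue) (complete_graph {..<r + 1})"
        unfolding contains_copy_def
        by (intro exI[of _ v]) (auto simp: complete_graph_def colour_class_def)
      then show False using nb by blast
    qed
    have "contains_copy (colour_class G c Red) T" if T: "T \<in> trees n D" for T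
    proof -
      have T': "is_tree T" "card (edges T) = n" "\<And>v. v \<in> verts T \<Longrightarrow> degree T v \<le> D"
        using T by (auto simp: trees_def)
      obtain x :: "nat \<Rightarrow> nat" and par where x: "bij_betw x {..n} (verts T)"
        and par: "\<And>i. i \<in> {1..n} \<Longrightarrow> par i < i"
        and ed: "edges T = (\<lambda>i. {x i, x (par i)}) ` {1..n}" "inj_on (\<lambda>i. {x i, x (par i)}) {1..n}"
        using tree_enumeration[OF T'(1,2)] by blast
      have children: "card {i \<in> {1..n}. par i = j} \<le> D" for j
        using tree_children_le_degree[OF x par ed T'(3)] .
      obtain g where g: "inj_on g {..n}" "g ` {..n} \<subseteq> W" "\<forall>i\<in>{1..n}. g i \<in> N (g (par i))"
        using embed_without_separated_sets[OF sym m par children W(1) size nosep] by blast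
      show ?thesis
      proof (rule contains_copy_tree[OF x par ed(1) g(1)])
        show "g ` {..n} \<subseteq> verts (colour_class G c Red)" using g(2) W(2) by (auto simp: colour_class_def)
        show "{g i, g (par i)} \<in> edges (colour_class G c Red)" if "i \<in> {1..n}" for i
          using g(3) that by (auto simp: N_def insert_commute)
      qed
    qed
    then show False using \<open>\<not> (\<forall>T\<in>trees n D. contains_copy (colour_class G c Red) T)\<close> by blast
  qed
qed

text \<open>A union bound over all families of \<open>r + 1\<close> disjoint \<open>m\<close>-sets.
  Only the first \<open>M\<close> vertices are used, so the number of families does not depend on
  \<open>N\<close>, which may be far larger than \<open>n\<close>.\<close>

lemma prob_arrows_ge:
  fixes p a :: real and r n m M N D :: nat
  assumes p: "0 \<le> p" "p \<le> 1" and MN: "M \<le> N" and m: "m \<ge> 1" and r: "r \<ge> 1"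
    and size: "r * (n + (2 * D + 4) * m) + m \<le> M" and a: "a > 0"
    and dense: "\<And>k. 2 \<le> k \<Longrightarrow> k \<le> r + 1 \<Longrightarrow> a \<le> m ^ k * p ^ (k choose 2)"
  shows "1 - 2 ^ (M * (r + 1)) * exp (- a / 2 ^ (r + 3)) \<le>
    measure_pmf.prob (erdos_renyi N p) {G. arrows G (complete_graph {..<r + 1}) (trees n D)}"
proof -
  define E where "E = edges (complete_graph {..<N})"
  define B where "B = bernoulli_field E p"
  define mk where "mk b = Graph {..<N} {e \<in> E. b e}" for b
  define U where "U = {b. arrows (mk b) (complete_graph {..<r + 1}) (trees n D)}"
  define \<F> where "\<F> = {X \<in> {..<r + 1} \<rightarrow>\<^sub>E Pow {..<M}. (\<forall>i<r + 1. card (X i) = m) \<and>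
     (\<forall>i<r + 1. \<forall>j<r + 1. i \<noteq> j \<longrightarrow> X i \<inter> X j = {})}"
  define bad where "bad X = {b. \<forall>v\<in>PiE {..<r + 1} X. \<not> (\<forall>e\<in>clique_edges (r + 1) v. b e)}"
    for X :: "nat \<Rightarrow> nat set"
  have finE: "finite E"
    unfolding E_def complete_graph_def by (rule finite_subset[of _ "Pow {..<N}"]) auto
  have fin\<F>: "finite \<F>"
    unfolding \<F>_def by (rule finite_subset[of _ "{..<r + 1} \<rightarrow>\<^sub>E Pow {..<M}"]) (auto intro!: finite_PiE)
  have "card \<F> \<le> card ({..<r + 1} \<rightarrow>\<^sub>E Pow {..<M})"
    unfolding \<F>_def by (intro card_mono finite_PiE) auto
  also have "\<dots> = 2 ^ (M * (r + 1))" by (simp add: card_funcsetE card_Pow power_mult power_add)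
  finally have card\<F>: "real (card \<F>) \<le> 2 ^ (M * (r + 1))"
    by (metis of_nat_le_iff of_nat_numeral of_nat_power)
  have classes: "disjoint_classes (r + 1) m X" if "X \<in> \<F>" for X
  proof
    show "X i \<inter> X j = {}" if "i < r + 1" "j < r + 1" "i \<noteq> j" for i j
      using \<open>X \<in> \<F>\<close> that by (simp add: \<F>_def)
    show "finite (X i)" if "i < r + 1" for i
    proof -
      have "X i \<in> Pow {..<M}" using \<open>X \<in> \<F>\<close> that by (intro PiE_mem[of X "{..<r + 1}"]) (auto simp: \<F>_def)
      then show ?thesis by (auto intro: finite_subset)
    qed
    show "card (X i) = m" if "i < r + 1" for i using \<open>X \<in> \<F>\<close> that by (simp add: \<F>_def)
  qed
  have clE: "clique_edges (r + 1) v \<subseteq> E" if X: "X \<in> \<F>" and v: "v \<in> PiE {..<r + 1} X" for X v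
  proof
    fix x assume "x \<in> clique_edges (r + 1) v"
    then obtain e where e: "e \<subseteq> {..<r + 1}" "card e = 2" "x = v ` e" by (auto simp: clique_edges_def)
    have "inj_on v e"
      using disjoint_classes.transversal_inj[OF classes[OF X] v] e(1) by (rule inj_on_subset)
    then have "card x = 2" using e by (simp add: card_image)
    moreover have "v i < N" if "i < r + 1" for i
    proof -
      have "v i \<in> X i" "X i \<in> Pow {..<M}"
        using X v that by (auto simp: \<F>_def intro: PiE_mem)
      then show ?thesis using MN by auto
    qed
    then have "x \<subseteq> {..<N}" using e by auto
    ultimately show "x \<in> E" by (simp add: E_def complete_graph_def)
  qed
  have "b \<in> U" if b: "b \<notin> (\<Union>X\<in>\<F>. bad X)" for b
  proof -
    have "arrows (mk b) (complete_graph {..<r + 1}) (trees n D)"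
    proof (rule arrows_of_transversal_cliques[where W = "{..<M}" and m = m])
      fix X :: "nat \<Rightarrow> nat set"
      assume X: "\<And>i. i < r + 1 \<Longrightarrow> X i \<subseteq> {..<M} \<and> card (X i) = m"
        "\<And>i j. i < r + 1 \<Longrightarrow> j < r + 1 \<Longrightarrow> i \<noteq> j \<Longrightarrow> X i \<inter> X j = {}"
      \<comment> \<open>Restricting the family to its index range puts it into the finite set over
        which the union bound runs.\<close>
      define X' where "X' = restrict X {..<r + 1}"
      have X': "X' \<in> \<F>" using X by (auto simp: \<F>_def X'_def)
      have eq: "PiE {..<r + 1} X' = PiE {..<r + 1} X" by (intro PiE_cong) (simp add: X'_def)
      obtain v where v: "v \<in> PiE {..<r + 1} X'" "\<forall>e\<in>clique_edges (r + 1) v. b e"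
        using b X' unfolding bad_def by blast
      then have "clique_edges (r + 1) v \<subseteq> edges (mk b)" using clE[OF X' v(1)] by (auto simp: mk_def)
      then show "\<exists>v\<in>PiE {..<r + 1} X. clique_edges (r + 1) v \<subseteq> edges (mk b)"
        using v(1) unfolding eq by blast
    qed (use m size MN in \<open>auto simp: mk_def\<close>)
    then show ?thesis by (simp add: U_def)
  qed
  then have sub: "- U \<subseteq> (\<Union>X\<in>\<F>. bad X)" by blast
  have "1 - measure_pmf.prob B U = measure_pmf.prob B (- U)"
    using measure_pmf.prob_compl[of U B] by (simp add: Compl_eq_Diff_UNIV)
  also have "\<dots> \<le> measure_pmf.prob B (\<Union>X\<in>\<F>. bad X)"
    using sub by (intro measure_pmf.finite_measure_mono) auto
  also have "\<dots> \<le> (\<Sum>X\<in>\<F>. measure_pmf.prob B (bad X))"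
    using fin\<F> by (intro measure_pmf.finite_measure_subadditive_finite) auto
  also have "\<dots> \<le> (\<Sum>X\<in>\<F>. exp (- a / 2 ^ (r + 3)))"
  proof (rule sum_mono)
    fix X assume X: "X \<in> \<F>"
    interpret disjoint_classes "r + 1" m X using classes[OF X] .
    show "measure_pmf.prob B (bad X) \<le> exp (- a / 2 ^ (r + 3))"
      using prob_no_transversal_clique[OF finE clE[OF X] _ p a dense] r
      by (simp add: bad_def B_def numeral_3_eq_3)
  qed
  also have "\<dots> = card \<F> * exp (- a / 2 ^ (r + 3))" by simp
  also have "\<dots> \<le> 2 ^ (M * (r + 1)) * exp (- a / 2 ^ (r + 3))"
    using card\<F> by (intro mult_right_mono) auto
  finally have "1 - 2 ^ (M * (r + 1)) * exp (- a / 2 ^ (r + 3)) \<le> measure_pmf.prob B U" by simp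
  also have "measure_pmf.prob B U =
    measure_pmf.prob (erdos_renyi N p) {G. arrows G (complete_graph {..<r + 1}) (trees n D)}"
    by (simp add: erdos_renyi_def B_def U_def mk_def E_def vimage_def)
  finally show ?thesis .
qed

text \<open>The power of \<open>n\<close> on the right has exponent
  \<open>k - k * (k - 1) / (r + 1)\<close>, which exceeds 1 by
  \<open>(k - 1) * (r + 1 - k) / (r + 1)\<close>. It equals 1 at \<open>k = r + 1\<close>, whence
  the threshold for \<open>p\<close>.\<close>

lemma clique_density_ge:
  fixes \<beta> C p :: real
  assumes \<beta>: "0 < \<beta>" "\<beta> \<le> 1" and C: "1 \<le> C" and n: "1 \<le> n" and m: "\<beta> * real n \<le> real m"
    and p: "C * real n powr (- 2 / (real r + 1)) \<le> p" and k: "2 \<le> k" "k \<le> r + 1"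
  shows "\<beta> ^ (r + 1) * C * real n \<le> real m ^ k * p ^ (k choose 2)"
proof -
  define c where "c = k choose 2"
  have "even (k * (k - 1))" by (cases k) auto
  then have "2 * c = k * (k - 1)" by (simp add: c_def choose_two)
  then have "real (2 * c) = real (k * (k - 1))" by simp
  then have c: "2 * real c = real k * (real k - 1)" using k by (simp add: of_nat_diff)
  have "c > 0" using k by (simp add: c_def)
  have "(real k - 1) * (real r + 1 - real k) \<ge> 0" using k by (intro mult_nonneg_nonneg) auto
  then have "2 * real c \<le> (real k - 1) * (real r + 1)" unfolding c by (simp add: algebra_simps)
  then have exponent: "1 \<le> real k - 2 * real c / (real r + 1)" by (simp add: field_simps)
  have "\<beta> ^ (r + 1) * C * real n \<le> \<beta> ^ k * C ^ c * real n powr (real k - 2 * real c / (real r + 1))"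
  proof (intro mult_mono)
    show "\<beta> ^ (r + 1) \<le> \<beta> ^ k" using \<beta> k by (intro power_decreasing) auto
    show "C \<le> C ^ c" using C \<open>c > 0\<close> by (simp add: self_le_power)
    show "real n \<le> real n powr (real k - 2 * real c / (real r + 1))"
      using powr_mono[OF exponent, of "real n"] n by simp
  qed (use \<beta> C in auto)
  also have "real n powr (real k - 2 * real c / (real r + 1)) =
      real n ^ k * (real n powr (- 2 / (real r + 1))) ^ c"
  proof -
    have "real k - 2 * real c / (real r + 1) = real k + real c * (- 2 / (real r + 1))" by simp
    then show ?thesis using n by (simp only: powr_add) (simp add: powr_power powr_realpow)
  qed
  also have "\<beta> ^ k * C ^ c * (real n ^ k * (real n powr (- 2 / (real r + 1))) ^ c) =
     (\<beta> * real n) ^ k * (C * real n powr (- 2 / (real r + 1))) ^ c"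
    by (simp add: power_mult_distrib)
  also have "\<dots> \<le> real m ^ k * p ^ c"
    using m p \<beta> C by (intro mult_mono power_mono) auto
  finally show ?thesis by (simp add: c_def)
qed

section \<open>Choice of constants and the limit\<close>

theorem theorem1p2:
  fixes r D :: nat and \<epsilon> :: real
  assumes "r \<ge> 2" and "D \<ge> 2" and "\<epsilon> > 0"
  shows "\<exists>C>0. \<forall>(p :: nat \<Rightarrow> real) (N :: nat \<Rightarrow> nat).
    (\<forall>n. 0 \<le> p n \<and> p n \<le> 1) \<longrightarrow>
    (\<forall>\<^sub>F n in sequentially. p n \<ge> C * real n powr (- 2 / (real r + 1))) \<longrightarrow>
    (\<forall>\<^sub>F n in sequentially. real (N n) \<ge> real r * real n + \<epsilon> * real n) \<longrightarrow>
    (\<lambda>n. measure_pmf.prob (erdos_renyi (N n) (p n))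
           {G. arrows G (complete_graph {..<r + 1}) (trees n D)}) \<longlonglongrightarrow> 1"
proof -
  \<comment> \<open>\<open>L\<close> is the coefficient of \<open>m\<close> in the size condition,
    so \<open>m \<le> \<delta> * n\<close> costs at most \<open>\<epsilon> * n\<close>. Rounding
    costs at most half of \<open>\<delta> * n\<close>, hence \<beta>. The number of families is at
    most \<open>exp (\<gamma> * n)\<close>, and \<open>A\<close> makes each failure probability
    \<open>exp (- (\<gamma> + 1) * n)\<close>. Finally \<open>C \<ge> 1\<close> ensures that powers
    of \<open>C\<close> are at least \<open>C\<close>.\<close>
  define L where "L = r * (2 * D + 4) + 1"
  define \<delta> where "\<delta> = \<epsilon> / L"
  define \<beta> where "\<beta> = min 1 (\<delta> / 2)"
  define \<gamma> where "\<gamma> = (r + \<epsilon> + 1) * (r + 1)"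
  define A where "A = 2 ^ (r + 3) * (\<gamma> + 1)"
  define C where "C = max 1 (A / \<beta> ^ (r + 1))"
  have L: "L > 0" by (simp add: L_def)
  then have \<delta>: "\<delta> > 0" using assms by (simp add: \<delta>_def)
  then have \<beta>: "0 < \<beta>" "\<beta> \<le> 1" by (auto simp: \<beta>_def)
  have "\<gamma> \<ge> 0" using assms by (simp add: \<gamma>_def)
  then have A: "A > 0" by (simp add: A_def)
  have "A / \<beta> ^ (r + 1) \<le> C" by (simp add: C_def)
  then have AC: "A \<le> \<beta> ^ (r + 1) * C" using \<beta> by (simp add: divide_le_eq mult.commute)
  show ?thesis
  proof (intro exI[of _ C] conjI allI impI)
    show "C > 0" by (simp add: C_def)
    fix p :: "nat \<Rightarrow> real" and N :: "nat \<Rightarrow> nat"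
    assume p01: "\<forall>n. 0 \<le> p n \<and> p n \<le> 1"
      and p: "\<forall>\<^sub>F n in sequentially. p n \<ge> C * real n powr (- 2 / (real r + 1))"
      and N: "\<forall>\<^sub>F n in sequentially. real (N n) \<ge> real r * real n + \<epsilon> * real n"
    define P where "P n = measure_pmf.prob (erdos_renyi (N n) (p n))
           {G. arrows G (complete_graph {..<r + 1}) (trees n D)}" for n
    \<comment> \<open>From here on \<open>\<delta> * n \<ge> 2\<close>, so rounding down keeps
      \<open>m\<close> positive and at least half of \<open>\<delta> * n\<close>; the summand 1
      gives \<open>n \<ge> 1\<close>.\<close>
    have "\<forall>\<^sub>F n in sequentially. n \<ge> nat \<lceil>2 / \<delta>\<rceil> + 1" by (rule eventually_ge_at_top)
    with p N have lower: "\<forall>\<^sub>F n in sequentially. 1 - exp (- real n) \<le> P n"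
    proof eventually_elim
      case (elim n)
      define m where "m = nat \<lfloor>\<delta> * n\<rfloor>"
      \<comment> \<open>The least integer that meets the size requirement on \<open>N n\<close>: it
        is at most \<open>N n\<close> and linear in \<open>n\<close>, as the union bound
        demands.\<close>
      define M where "M = nat \<lceil>(r + \<epsilon>) * n\<rceil>"
      have n: "n \<ge> 1" using elim(3) by simp
      have "2 / \<delta> \<le> n" using elim(3) by linarith
      then have \<delta>n: "2 \<le> \<delta> * n" using \<delta> by (simp add: divide_le_eq mult.commute)
      have m_up: "real m \<le> \<delta> * n" using \<delta>n by (simp add: m_def)
      have "\<delta> * n < m + 1" using \<delta>n by (simp add: m_def) linarith
      then have m1: "m \<ge> 1" and "\<delta> / 2 * n \<le> m" using \<delta>n by linarith+
      moreover have "\<beta> * n \<le> \<delta> / 2 * n" by (intro mult_right_mono) (auto simp: \<beta>_def)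
      ultimately have m_low: "\<beta> * n \<le> m" by linarith
      have nn: "0 \<le> (r + \<epsilon>) * n" using assms by simp
      have M_low: "(r + \<epsilon>) * n \<le> M" unfolding M_def by (rule real_nat_ceiling_ge)
      have "real M \<le> (r + \<epsilon>) * n + 1" using nn unfolding M_def by linarith
      then have M_up: "real M \<le> (r + \<epsilon> + 1) * n" using n by (simp add: distrib_right)
      have "(r + \<epsilon>) * n \<le> real (N n)" using elim(2) by (simp add: distrib_right)
      then have MN: "M \<le> N n" by (simp add: M_def ceiling_le_iff)
      have "real (r * (n + (2 * D + 4) * m) + m) = real r * n + real L * m"
        by (simp add: L_def algebra_simps)
      also have "\<dots> \<le> real r * n + real L * (\<delta> * n)" using m_up by (intro add_left_mono mult_left_mono) auto
      also have "L * (\<delta> * n) = \<epsilon> * n" using L by (simp add: \<delta>_def)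
      finally have "real (r * (n + (2 * D + 4) * m) + m) \<le> real M"
        using M_low by (simp add: distrib_right)
      then have size: "r * (n + (2 * D + 4) * m) + m \<le> M" by (simp only: of_nat_le_iff)
      have dense: "A * n \<le> m ^ k * p n ^ (k choose 2)" if "2 \<le> k" "k \<le> r + 1" for k
      proof -
        have "A * n \<le> \<beta> ^ (r + 1) * C * n" using AC by (intro mult_right_mono) auto
        also have "\<dots> \<le> m ^ k * p n ^ (k choose 2)"
          using clique_density_ge[OF \<beta> _ n m_low elim(1) that] by (simp add: C_def)
        finally show ?thesis .
      qed
      have "1 - 2 ^ (M * (r + 1)) * exp (- (A * n) / 2 ^ (r + 3)) \<le> P n"
        unfolding P_def using p01 A n assms(1)
        by (intro prob_arrows_ge[OF _ _ MN m1 _ size _ dense]) auto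
      moreover have "2 ^ (M * (r + 1)) * exp (- (A * n) / 2 ^ (r + 3)) \<le> exp (- real n)"
      proof -
        have "(2 :: real) \<le> exp 1" using exp_ge_add_one_self[of 1] by simp
        then have "(2 :: real) ^ (M * (r + 1)) \<le> exp 1 ^ (M * (r + 1))" by (intro power_mono) auto
        also have "\<dots> = exp (M * (r + 1))" by (simp flip: exp_of_nat_mult)
        also have "\<dots> \<le> exp (\<gamma> * n)"
          using mult_right_mono[OF M_up, of "r + 1"] by (simp add: \<gamma>_def algebra_simps)
        finally have "2 ^ (M * (r + 1)) * exp (- (A * n) / 2 ^ (r + 3)) \<le>
           exp (\<gamma> * n) * exp (- (A * n) / 2 ^ (r + 3))" by (rule mult_right_mono) simp
        moreover have "- (A * n) / 2 ^ (r + 3) = - ((\<gamma> + 1) * n)" by (simp add: A_def)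
        moreover have "exp (\<gamma> * n) * exp (- ((\<gamma> + 1) * n)) = exp (- real n)"
          by (simp add: algebra_simps flip: exp_add)
        ultimately show ?thesis by (simp only:)
      qed
      ultimately show ?case by linarith
    qed
    have upper: "\<forall>\<^sub>F n in sequentially. P n \<le> 1" by (simp add: P_def)
    have "(\<lambda>n. 1 - exp (- real n)) \<longlonglongrightarrow> 1" by real_asymp
    from tendsto_sandwich[OF lower upper this tendsto_const]
    show "(\<lambda>n. measure_pmf.prob (erdos_renyi (N n) (p n))
           {G. arrows G (complete_graph {..<r + 1}) (trees n D)}) \<longlonglongrightarrow> 1"
      by (simp only: P_def)
  qed
qed

end
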